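(* Let $k_1=2$ and $2\le t\le\min\{k_2,d\}$. The minimal decomposition of $\sqrt{\mathcal I_C}$ in terms of the ideals $I_S$ is $$\sqrt{\mathcal I_C}=\bigcap_{S\text{ minimal}}\sqrt{I_S},$$ where the intersection is over all minimal subsets $S\subseteq[2]\times[k_2]$ (minimal in the combinatorial sense defined in the context). That is, this equality holds, and for $S\subseteq [2]\times[k_2]$ the subset $S$ is minimal if and only if $I_S$ is minimal with respect to inclusion among the ideals $\{I_{S'}:S'\subseteq[2]\times[k_2]\}$.
   Context: Let $k_2,d,t$ be integers with $2\le t\le\min\{k_2,d\}$; write $[n]=\{1,\dots,n\}$. Let $X=(x_{i(j,\ell)})$ be the $d\times 2k_2$ matrix of indeterminates with rows $i\in[d]$ and columns $(j,\ell)\in[2]\times[k_2]$, and $\mathbb C[X]$ the polynomial ring over $\mathbb C$ in its entries. For $U\subseteq[2]\times[k_2]$, $X_U$ is the submatrix of $X$ with columns indexed by $U$. For a submatrix $Y$ of $X$, $F_r(Y)$ denotes the set of $r$-minors of $Y$. Put $R_i=\{i\}\times[k_2]$ and $C_j=[2]\times\{j\}$. The ideal $\mathcal I_C\subseteq\mathbb C[X]$ is generated by all $2$-minors of $X_{C_j}$ ($j\in[k_2]$) and all $t$-minors of $X_{R_i}$ ($i\in[2]$). For $S\subseteq[2]\times[k_2]$ let $\mathcal C(S)$ be the union of all $C_j$ with $C_j\cap S=\emptyset$. Let $F_\emptyset=\bigcup_{j\in[k_2]}F_2(X_{C_j})\cup F_t(X)$ and, for $S\ne\emptyset$, $$F_S=F_1(X_S)\cup\bigcup_{j\in[k_2],\,C_j\cap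 S=\emptyset}F_2(X_{C_j})\cup G_S\cup F_t(X_{(R_1\setminus S)\cup\mathcal C(S)})\cup F_t(X_{(R_2\setminus S)\cup\mathcal C(S)}),$$ where $G_S=F_{t-1}(X_{\mathcal C(S)})$ if there is $j$ with $(1,j)\in S,(2,j)\notin S$ and there is $j'$ with $(2,j')\in S,(1,j')\notin S$, and $G_S=\emptyset$ otherwise. $I_S\subseteq\mathbb C[X]$ is the ideal generated by $F_S$. If $S$ contains no $C_j$, its combinatorial type is $(u,v)$ with $u=\min\{|R_1\cap S|,|R_2\cap S|\}$, $v=\max\{|R_1\cap S|,|R_2\cap S|\}$. A subset $S$ is called minimal if $S=\emptyset$, or all of the following hold: (1) $C_j\not\subseteq S$ for all $j\in[k_2]$; (2) its type $(u,v)$ satisfies $1\le u\le v\le k_2-t+1$; (3) if $t=2$, then additionally $u+v=k_2$. *)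

theory Defs
  imports
    Complex_Main
    "HOL-Library.Poly_Mapping"
    "HOL-Algebra.Ideal"
    "Jordan_Normal_Form.Determinant"
    "Jordan_Normal_Form.DL_Submatrix"
begin

section \<open>Polynomial rings and radicals\<close>

text \<open>
  A polynomial is a finitely supported map from monomials to coefficients, a monomial being a
  finitely supported exponent map on the variables. The carrier of \<open>poly_ring V\<close> consists of the
  polynomials that only involve variables from \<open>V\<close>.
\<close>

type_synonym ('v, 'a) mpoly = "('v \<Rightarrow>\<^sub>0 nat) \<Rightarrow>\<^sub>0 'a"

definition poly_ring :: "'v set \<Rightarrow> ('v, 'a::comm_ring_1) mpoly ring" where
  "poly_ring V =
    \<lparr>carrier = {p. \<forall>m\<in>Poly_Mapping.keys p. Poly_Mapping.keys m \<subseteq> V},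
     monoid.mult = (*), one = 1, zero = 0, add = (+)\<rparr>"

definition indet :: "'v \<Rightarrow> ('v, 'a::comm_ring_1) mpoly" where
  "indet v = Poly_Mapping.single (Poly_Mapping.single v 1) 1"

definition radical :: "('a, 'b) ring_scheme \<Rightarrow> 'a set \<Rightarrow> 'a set" where
  "radical R I = {f \<in> carrier R. \<exists>n::nat. n \<ge> 1 \<and> f [^]\<^bsub>R\<^esub> n \<in> I}"

lemma poly_ring_simps:
  "carrier (poly_ring V) = {p. \<forall>m\<in>Poly_Mapping.keys p. Poly_Mapping.keys m \<subseteq> V}"
  "x \<otimes>\<^bsub>poly_ring V\<^esub> y = x * y" "\<one>\<^bsub>poly_ring V\<^esub> = 1"
  "x \<oplus>\<^bsub>poly_ring V\<^esub> y = x + y" "\<zero>\<^bsub>poly_ring V\<^esub> = 0"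
  by (simp_all add: poly_ring_def)

lemma poly_ring_closed:
  shows "0 \<in> carrier (poly_ring V)" "1 \<in> carrier (poly_ring V)"
    and "p \<in> carrier (poly_ring V) \<Longrightarrow> - p \<in> carrier (poly_ring V)"
    and "p \<in> carrier (poly_ring V) \<Longrightarrow> q \<in> carrier (poly_ring V) \<Longrightarrow> p + q \<in> carrier (poly_ring V)"
    and "p \<in> carrier (poly_ring V) \<Longrightarrow> q \<in> carrier (poly_ring V) \<Longrightarrow> p * q \<in> carrier (poly_ring V)"
proof -
  show "0 \<in> carrier (poly_ring V)" "1 \<in> carrier (poly_ring V)"
    by (auto simp: poly_ring_simps)
  show "p \<in> carrier (poly_ring V) \<Longrightarrow> - p \<in> carrier (poly_ring V)"
    by (auto simp: poly_ring_simps)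
  show "p \<in> carrier (poly_ring V) \<Longrightarrow> q \<in> carrier (poly_ring V) \<Longrightarrow> p + q \<in> carrier (poly_ring V)"
    using keys_add[of p q] by (fastforce simp: poly_ring_simps)
  assume p: "p \<in> carrier (poly_ring V)" and q: "q \<in> carrier (poly_ring V)"
  show "p * q \<in> carrier (poly_ring V)"
    unfolding poly_ring_simps
  proof (intro CollectI ballI)
    fix m assume "m \<in> Poly_Mapping.keys (p * q)"
    then obtain a b where "m = a + b" "a \<in> Poly_Mapping.keys p" "b \<in> Poly_Mapping.keys q"
      using keys_mult[of p q] by blast
    then show "Poly_Mapping.keys m \<subseteq> V"
      using p q keys_add[of a b] by (fastforce simp: poly_ring_simps)
  qed
qed

lemma cring_poly_ring: "cring (poly_ring V)"
proof (rule cringI)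
  show "abelian_group (poly_ring V)"
  proof (rule abelian_groupI)
    fix x assume "x \<in> carrier (poly_ring V)"
    then show "\<exists>y\<in>carrier (poly_ring V). y \<oplus>\<^bsub>poly_ring V\<^esub> x = \<zero>\<^bsub>poly_ring V\<^esub>"
      using poly_ring_closed(3)[of x V] by (intro bexI[of _ "- x"]) (auto simp: poly_ring_simps(2-))
  qed (auto simp: poly_ring_simps(2-) poly_ring_closed algebra_simps)
  show "Group.comm_monoid (poly_ring V)"
    by (rule comm_monoidI) (auto simp: poly_ring_simps(2-) poly_ring_closed algebra_simps)
qed (auto simp: poly_ring_simps(2-) algebra_simps)


section \<open>The generic matrix and its minors\<close>

text \<open>
  A column is a pair \<open>(j, l)\<close>, and the indeterminate in row \<open>i\<close> and column \<open>(j, l)\<close> is the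
  variable \<open>(i, (j, l))\<close>; all these indices start at 1, while the positions in a matrix of type
  \<open>mat\<close> start at 0.
\<close>

type_synonym col = "nat \<times> nat"
type_synonym cpoly = "(nat \<times> col, complex) mpoly"

definition columns :: "nat \<Rightarrow> col set" where
  "columns k2 = {1..2} \<times> {1..k2}"

definition CX :: "nat \<Rightarrow> nat \<Rightarrow> cpoly ring" where
  "CX d k2 = poly_ring ({1..d} \<times> columns k2)"

text \<open>The submatrix \<open>X\<^sub>U\<close>, with its columns in lexicographic order.\<close>

definition Xsub :: "nat \<Rightarrow> nat \<Rightarrow> col set \<Rightarrow> cpoly mat" where
  "Xsub d k2 U =
    (let cs = filter (\<lambda>c. c \<in> U) (List.product [1..<3] [1..<Suc k2])
     in mat d (length cs) (\<lambda>(i, j). indet (Suc i, cs ! j)))"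

definition minors :: "nat \<Rightarrow> 'a::comm_ring_1 mat \<Rightarrow> 'a set" where
  "minors r Y = {det (submatrix Y I J) | I J.
     I \<subseteq> {..<dim_row Y} \<and> card I = r \<and> J \<subseteq> {..<dim_col Y} \<and> card J = r}"

definition Rblock :: "nat \<Rightarrow> nat \<Rightarrow> col set" where
  "Rblock k2 i = {i} \<times> {1..k2}"

definition Cblock :: "nat \<Rightarrow> col set" where
  "Cblock j = {1..2} \<times> {j}"

definition I_C :: "nat \<Rightarrow> nat \<Rightarrow> nat \<Rightarrow> cpoly set" where
  "I_C d k2 t = Idl\<^bsub>CX d k2\<^esub>
     ((\<Union>j\<in>{1..k2}. minors 2 (Xsub d k2 (Cblock j))) \<union>
      (\<Union>i\<in>{1..2}. minors t (Xsub d k2 (Rblock k2 i))))"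


section \<open>The ideals \<open>I\<^sub>S\<close>\<close>

definition Cfree :: "nat \<Rightarrow> col set \<Rightarrow> col set" where
  "Cfree k2 S = (\<Union>j\<in>{j\<in>{1..k2}. Cblock j \<inter> S = {}}. Cblock j)"

definition G_S :: "nat \<Rightarrow> nat \<Rightarrow> nat \<Rightarrow> col set \<Rightarrow> cpoly set" where
  "G_S d k2 t S =
    (if (\<exists>j\<in>{1..k2}. (1, j) \<in> S \<and> (2, j) \<notin> S) \<and> (\<exists>j\<in>{1..k2}. (2, j) \<in> S \<and> (1, j) \<notin> S)
     then minors (t - 1) (Xsub d k2 (Cfree k2 S)) else {})"

definition F_S :: "nat \<Rightarrow> nat \<Rightarrow> nat \<Rightarrow> col set \<Rightarrow> cpoly set" where
  "F_S d k2 t S =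
    (if S = {} then
       (\<Union>j\<in>{1..k2}. minors 2 (Xsub d k2 (Cblock j))) \<union> minors t (Xsub d k2 (columns k2))
     else
       minors 1 (Xsub d k2 S) \<union>
       (\<Union>j\<in>{j\<in>{1..k2}. Cblock j \<inter> S = {}}. minors 2 (Xsub d k2 (Cblock j))) \<union>
       G_S d k2 t S \<union>
       minors t (Xsub d k2 ((Rblock k2 1 - S) \<union> Cfree k2 S)) \<union>
       minors t (Xsub d k2 ((Rblock k2 2 - S) \<union> Cfree k2 S)))"

definition I_S :: "nat \<Rightarrow> nat \<Rightarrow> nat \<Rightarrow> col set \<Rightarrow> cpoly set" where
  "I_S d k2 t S = Idl\<^bsub>CX d k2\<^esub> (F_S d k2 t S)"


section \<open>Minimal subsets\<close>

text \<open>The combinatorial type is only meaningful if \<open>S\<close> contains no \<open>Cblock j\<close>.\<close>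

definition comb_type :: "nat \<Rightarrow> col set \<Rightarrow> nat \<times> nat" where
  "comb_type k2 S =
    (min (card (Rblock k2 1 \<inter> S)) (card (Rblock k2 2 \<inter> S)),
     max (card (Rblock k2 1 \<inter> S)) (card (Rblock k2 2 \<inter> S)))"

text \<open>Used only for \<open>t \<le> k2\<close>, so that the subtraction does not truncate.\<close>

definition minimal_subset :: "nat \<Rightarrow> nat \<Rightarrow> col set \<Rightarrow> bool" where
  "minimal_subset k2 t S \<longleftrightarrow>
    S = {} \<or>
    ((\<forall>j\<in>{1..k2}. \<not> Cblock j \<subseteq> S) \<and>
     (case comb_type k2 S of (u, v) \<Rightarrow>
        1 \<le> u \<and> u \<le> v \<and> v \<le> k2 - t + 1 \<and> (t = 2 \<longrightarrow> u + v = k2)))"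


section \<open>The generators lie in the polynomial ring\<close>

text \<open>
  \<open>Idl\<close> is the intersection of all ideals containing the given set, so it only has its intended
  meaning for subsets of the carrier.
\<close>

lemma sum_closed_poly_ring:
  "(\<And>x. x \<in> A \<Longrightarrow> f x \<in> carrier (poly_ring V)) \<Longrightarrow> (\<Sum>x\<in>A. f x) \<in> carrier (poly_ring V)"
  by (induction A rule: infinite_finite_induct) (auto simp: poly_ring_closed)

lemma prod_closed_poly_ring:
  "(\<And>x. x \<in> A \<Longrightarrow> f x \<in> carrier (poly_ring V)) \<Longrightarrow> (\<Prod>x\<in>A. f x) \<in> carrier (poly_ring V)"
  by (induction A rule: infinite_finite_induct) (auto simp: poly_ring_closed)

lemma det_closed_poly_ring:
  assumes "\<And>i j. i < dim_row A \<Longrightarrow> j < dim_col A \<Longrightarrow> A $$ (i, j) \<in> carrier (poly_ring V)"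
  shows "det A \<in> carrier (poly_ring V)"
proof -
  have "signof p * (\<Prod>i = 0..<dim_row A. A $$ (i, p i)) \<in> carrier (poly_ring V)"
    if "dim_row A = dim_col A" "p permutes {0..<dim_row A}" for p
  proof (rule poly_ring_closed(5))
    show "signof p \<in> carrier (poly_ring V)"
      by (auto simp: sign_def poly_ring_closed)
    show "(\<Prod>i = 0..<dim_row A. A $$ (i, p i)) \<in> carrier (poly_ring V)"
      using that permutes_in_image[OF that(2)]
      by (intro prod_closed_poly_ring assms) auto
  qed
  then show ?thesis
    unfolding det_def by (auto intro!: sum_closed_poly_ring simp: poly_ring_closed)
qed

lemma minors_closed: "minors r (Xsub d k2 U) \<subseteq> carrier (CX d k2)"
proof
  fix f assume "f \<in> minors r (Xsub d k2 U)"
  then obtain I J where f: "f = det (submatrix (Xsub d k2 U) I J)"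
    unfolding minors_def by blast
  let ?X = "Xsub d k2 U"
  let ?cs = "filter (\<lambda>c. c \<in> U) (List.product [1..<3] [1..<Suc k2])"
  have entry: "?X $$ (i, j) \<in> carrier (CX d k2)" if "i < dim_row ?X" "j < dim_col ?X" for i j
  proof -
    have ij: "i < d" "j < length ?cs" using that by (auto simp: Xsub_def Let_def)
    then have "?cs ! j \<in> columns k2"
      using nth_mem[OF ij(2)] by (auto simp: columns_def)
    then show ?thesis
      using ij by (auto simp: Xsub_def Let_def CX_def poly_ring_def indet_def)
  qed
  show "f \<in> carrier (CX d k2)"
    unfolding f CX_def
  proof (rule det_closed_poly_ring)
    fix i j
    assume "i < dim_row (submatrix ?X I J)" "j < dim_col (submatrix ?X I J)"
    then have "i < card {i. i < dim_row ?X \<and> i \<in> I}" "j < card {j. j < dim_col ?X \<and> j \<in> J}"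
      by (simp_all add: dim_submatrix)
    then show "submatrix ?X I J $$ (i, j) \<in> carrier (poly_ring ({1..d} \<times> columns k2))"
      using entry[of "pick I i" "pick J j"] pick_le[of i "dim_row ?X" I] pick_le[of j "dim_col ?X" J]
      by (simp add: submatrix_index CX_def)
  qed
qed

lemma F_S_closed: "F_S d k2 t S \<subseteq> carrier (CX d k2)"
  using minors_closed by (auto simp: F_S_def G_S_def subset_iff)

end

theory Submission
  imports Defs
    "HOL-Analysis.Continuum_Not_Denumerable"
    "HOL-Computational_Algebra.Fundamental_Theorem_Algebra"
begin

text \<open>
  Think of the columns of the matrix as arranged in two rows of blocks \<open>Rblock k2 1\<close>, \<open>Rblock k2 2\<close>
  and \<open>k2\<close> blocks \<open>Cblock j\<close> of two columns each. A point of the variety of \<open>I\<^sub>C\<close> is a matrix both of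
  whose rows have rank below \<open>t\<close> and in whose blocks the two columns are parallel. Parallel nonzero
  columns span the same line, so the two rows can only differ in their spans through blocks with
  exactly one zero column, and the sets \<open>S\<close> record where the zero columns are.

  Minimality is decided on the level of the ideals. If \<open>S\<close> violates one of the combinatorial
  conditions, a smaller ideal is obtained by removing one element from \<open>S\<close>, by adding one, or by
  passing to the empty set (\<open>smaller_I_S_if_not_minimal\<close>). The inclusion is checked on generators:
  a minor with a column in \<open>S\<close> lies in \<open>I\<^sub>S\<close> by expansion along this column, and a minor that uses
  both columns of a block lies in the ideal generated by the 2-minors of this block, which happens
  by the pigeonhole principle as soon as there are fewer blocks than columns in the minor.
  Conversely, a non-inclusion is witnessed by a point, for which matrices suffice whose columns are
  unit vectors or zero; if \<open>S\<close> is minimal, such points show that only \<open>S\<close> itself has an ideal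
  contained in \<open>I\<^sub>S\<close> (\<open>eq_if_I_S_subset_minimal\<close>).

  For the equality of radicals, \<open>I\<^sub>C \<subseteq> I\<^sub>S\<close> holds for all \<open>S\<close>. In the other direction, a polynomial \<open>f\<close>
  outside of the radical of \<open>I\<^sub>C\<close> has a nonzero value at some point of the variety (\<open>nullstellensatz\<close>).
  A rank argument puts this point on the variety of some \<open>I\<^sub>S\<close>
  (\<open>I_S_vanishing_at_point_of_I_C\<close>). There are only finitely many subsets, so below \<open>I\<^sub>S\<close> there is an
  inclusion-minimal ideal; it belongs to a minimal subset by the
  characterisation of minimality, vanishes at the point,
  and hence no power of \<open>f\<close> lies in it.

  The Nullstellensatz is proved in the form that is special to uncountable fields, where a dimension
  count replaces Noether normalisation. Ranks are treated through minors and Cramer's rule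
  throughout, so that vanishing of minors at a point and membership of minors in an ideal are
  statements of the same shape.
\<close>

section \<open>Evaluation of multivariate polynomials\<close>

definition eval_monom :: "('v \<Rightarrow> 'a::comm_ring_1) \<Rightarrow> ('v \<Rightarrow>\<^sub>0 nat) \<Rightarrow> 'a" where
  "eval_monom x m = (\<Prod>v\<in>Poly_Mapping.keys m. x v ^ Poly_Mapping.lookup m v)"

definition eval_mpoly :: "('v \<Rightarrow> 'a::comm_ring_1) \<Rightarrow> ('v, 'a) mpoly \<Rightarrow> 'a" where
  "eval_mpoly x p = (\<Sum>m\<in>Poly_Mapping.keys p. Poly_Mapping.lookup p m * eval_monom x m)"

lemma eval_monom_superset:
  assumes "finite K" "Poly_Mapping.keys m \<subseteq> K"
  shows "eval_monom x m = (\<Prod>v\<in>K. x v ^ Poly_Mapping.lookup m v)"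
  unfolding eval_monom_def
  by (rule prod.mono_neutral_left) (use assms in \<open>auto simp: in_keys_iff\<close>)

lemma eval_monom_add: "eval_monom x (m + n) = eval_monom x m * eval_monom x n"
proof -
  let ?K = "Poly_Mapping.keys m \<union> Poly_Mapping.keys n"
  have "eval_monom x (m + n) = (\<Prod>v\<in>?K. x v ^ Poly_Mapping.lookup (m + n) v)"
    by (rule eval_monom_superset) (use keys_add[of m n] in auto)
  also have "\<dots> = (\<Prod>v\<in>?K. x v ^ Poly_Mapping.lookup m v) * (\<Prod>v\<in>?K. x v ^ Poly_Mapping.lookup n v)"
    by (simp add: lookup_add power_add prod.distrib)
  also have "\<dots> = eval_monom x m * eval_monom x n"
    by (simp add: eval_monom_superset[of ?K])
  finally show ?thesis .
qed

lemma eval_mpoly_superset: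
  assumes "finite K" "Poly_Mapping.keys p \<subseteq> K"
  shows "eval_mpoly x p = (\<Sum>m\<in>K. Poly_Mapping.lookup p m * eval_monom x m)"
  unfolding eval_mpoly_def
  by (rule sum.mono_neutral_left) (use assms in \<open>auto simp: in_keys_iff\<close>)

lemma eval_mpoly_add: "eval_mpoly x (p + q) = eval_mpoly x p + eval_mpoly x q"
proof -
  let ?K = "Poly_Mapping.keys p \<union> Poly_Mapping.keys q"
  have "eval_mpoly x (p + q) = (\<Sum>m\<in>?K. Poly_Mapping.lookup (p + q) m * eval_monom x m)"
    by (rule eval_mpoly_superset) (use keys_add[of p q] in auto)
  also have "\<dots> = (\<Sum>m\<in>?K. Poly_Mapping.lookup p m * eval_monom x m)
      + (\<Sum>m\<in>?K. Poly_Mapping.lookup q m * eval_monom x m)"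
    by (simp add: lookup_add distrib_right sum.distrib)
  also have "\<dots> = eval_mpoly x p + eval_mpoly x q"
    by (simp add: eval_mpoly_superset[of ?K])
  finally show ?thesis .
qed

lemma eval_mpoly_zero: "eval_mpoly x 0 = 0"
  by (simp add: eval_mpoly_def)

lemma eval_mpoly_single: "eval_mpoly x (Poly_Mapping.single m c) = c * eval_monom x m"
  by (simp add: eval_mpoly_superset[of "{m}"])

lemma mpoly_sum_singles:
  "p = (\<Sum>m\<in>Poly_Mapping.keys p. Poly_Mapping.single m (Poly_Mapping.lookup p m))"
  by (rule poly_mapping_eqI) (auto simp: lookup_sum lookup_single when_def in_keys_iff)

lemma eval_mpoly_sum: "eval_mpoly x (sum g A) = (\<Sum>a\<in>A. eval_mpoly x (g a))"
  by (induction A rule: infinite_finite_induct) (auto simp: eval_mpoly_add eval_mpoly_zero)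

lemma eval_mpoly_mult: "eval_mpoly x (p * q) = eval_mpoly x p * eval_mpoly x q"
proof -
  let ?s = "\<lambda>p m. Poly_Mapping.single m (Poly_Mapping.lookup p m)"
  have "p * q = (\<Sum>m\<in>Poly_Mapping.keys p. ?s p m) * (\<Sum>n\<in>Poly_Mapping.keys q. ?s q n)"
    by (subst mpoly_sum_singles[of p], subst mpoly_sum_singles[of q]) simp
  then have "eval_mpoly x (p * q) = (\<Sum>m\<in>Poly_Mapping.keys p. \<Sum>n\<in>Poly_Mapping.keys q.
      Poly_Mapping.lookup p m * eval_monom x m * (Poly_Mapping.lookup q n * eval_monom x n))"
    by (simp add: sum_product eval_mpoly_sum mult_single eval_mpoly_single eval_monom_add mult_ac)
  then show ?thesis
    by (simp add: sum_product eval_mpoly_def)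
qed

lemma eval_mpoly_const: "eval_mpoly x (Poly_Mapping.single 0 c) = c"
  by (simp add: eval_mpoly_single eval_monom_def)

lemma eval_mpoly_indet: "eval_mpoly x (indet v) = x v"
  by (simp add: indet_def eval_mpoly_single eval_monom_def)

lemma comm_ring_hom_eval_mpoly: "comm_ring_hom (eval_mpoly x)"
  by unfold_locales
    (auto simp: eval_mpoly_add eval_mpoly_mult eval_mpoly_zero eval_mpoly_const simp flip: single_one)

interpretation eval: comm_ring_hom "eval_mpoly x" for x
  by (rule comm_ring_hom_eval_mpoly)


section \<open>Ideals of the polynomial ring\<close>

lemma ring_poly_ring: "ring (poly_ring V)"
  using cring_poly_ring cring.axioms(1) by blast

text \<open>Generated ideals and the radical are built on records with an explicit carrier;
  this turns membership arguments into arithmetic of the type of polynomials.\<close>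

lemma ideal_poly_ring_iff:
  "ideal J (poly_ring V) \<longleftrightarrow> J \<subseteq> carrier (poly_ring V) \<and> 0 \<in> J \<and>
     (\<forall>a\<in>J. \<forall>b\<in>J. a + b \<in> J) \<and> (\<forall>r\<in>carrier (poly_ring V). \<forall>a\<in>J. r * a \<in> J)"
  (is "?L \<longleftrightarrow> ?R")
proof
  assume ?L
  note add = additive_subgroup.a_subset additive_subgroup.zero_closed additive_subgroup.a_closed
  from \<open>?L\<close> have "additive_subgroup J (poly_ring V)" by (rule ideal.axioms(1))
  note this[THEN add(1)] this[THEN add(2), unfolded poly_ring_simps(2-)]
    this[THEN add(3), unfolded poly_ring_simps(2-)]
  moreover note ideal.I_l_closed[OF \<open>?L\<close>, unfolded poly_ring_simps(2-)]
  ultimately show ?R by simp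
next
  assume R: ?R
  interpret ring "poly_ring V" by (rule ring_poly_ring)
  show ?L
  proof (rule idealI[OF ring_poly_ring])
    show "subgroup J (add_monoid (poly_ring V))"
    proof
      fix x assume x: "x \<in> J"
      have "\<ominus>\<^bsub>poly_ring V\<^esub> x = - x"
        using R x poly_ring_closed(3)[of x V] by (intro minus_equality) (auto simp: poly_ring_simps(2-))
      moreover have "- 1 \<in> carrier (poly_ring V)" by (intro poly_ring_closed)
      ultimately show "inv\<^bsub>add_monoid (poly_ring V)\<^esub> x \<in> J"
        using R x unfolding a_inv_def by fastforce
    qed (use R in \<open>auto simp: poly_ring_simps(2-)\<close>)
  qed (use R in \<open>metis poly_ring_simps(2) mult.commute\<close>)+
qed

lemma ideal_poly_ringD:
  assumes "ideal J (poly_ring V)"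
  shows "J \<subseteq> carrier (poly_ring V)" "0 \<in> J"
    and "\<And>a b. a \<in> J \<Longrightarrow> b \<in> J \<Longrightarrow> a + b \<in> J"
    and "\<And>r a. r \<in> carrier (poly_ring V) \<Longrightarrow> a \<in> J \<Longrightarrow> r * a \<in> J"
    and "\<And>a. a \<in> J \<Longrightarrow> - a \<in> J"
    and "\<And>a b. a \<in> J \<Longrightarrow> b \<in> J \<Longrightarrow> a - b \<in> J"
proof -
  note R = assms[unfolded ideal_poly_ring_iff]
  show sub: "J \<subseteq> carrier (poly_ring V)" and zero: "0 \<in> J"
    and add: "\<And>a b. a \<in> J \<Longrightarrow> b \<in> J \<Longrightarrow> a + b \<in> J"
    and mult: "\<And>r a. r \<in> carrier (poly_ring V) \<Longrightarrow> a \<in> J \<Longrightarrow> r * a \<in> J"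
    using R by auto
  have "- 1 \<in> carrier (poly_ring V)" by (intro poly_ring_closed)
  then show minus: "- a \<in> J" if "a \<in> J" for a
    using mult[of "- 1" a] that by auto
  show "a - b \<in> J" if "a \<in> J" "b \<in> J" for a b
    using add[OF that(1) minus[OF that(2)]] by simp
qed

lemma ideal_poly_ring_sum:
  assumes "ideal J (poly_ring V)" "\<And>a. a \<in> A \<Longrightarrow> g a \<in> J"
  shows "(\<Sum>a\<in>A. g a) \<in> J"
  using assms(2)
  by (induction A rule: infinite_finite_induct) (auto intro: ideal_poly_ringD(2,3)[OF assms(1)])

lemma pow_closed_poly_ring:
  "f \<in> carrier (poly_ring V) \<Longrightarrow> f ^ n \<in> carrier (poly_ring V)"
  by (induction n) (auto intro: poly_ring_closed)

lemma diff_closed_poly_ring: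
  "f \<in> carrier (poly_ring V) \<Longrightarrow> g \<in> carrier (poly_ring V) \<Longrightarrow> f - g \<in> carrier (poly_ring V)"
  using poly_ring_closed(4)[OF _ poly_ring_closed(3)] by fastforce

lemma const_closed_poly_ring: "Poly_Mapping.single 0 c \<in> carrier (poly_ring V)"
  by (auto simp: poly_ring_simps)

lemma indet_closed_poly_ring: "v \<in> V \<Longrightarrow> indet v \<in> carrier (poly_ring V)"
  by (auto simp: poly_ring_simps indet_def)

lemma nat_pow_poly_ring: "f [^]\<^bsub>poly_ring V\<^esub> (n::nat) = f ^ n"
proof (induction n)
  case (Suc n)
  then show ?case by (simp add: nat_pow_def poly_ring_simps(2-) mult.commute)
qed (simp add: nat_pow_def poly_ring_simps(2-))

lemma radical_poly_ring:
  "radical (poly_ring V) I = {f \<in> carrier (poly_ring V). \<exists>n\<ge>1. f ^ n \<in> I}"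
  by (auto simp: radical_def nat_pow_poly_ring)

lemma ideal_vanishing_at: "ideal {f \<in> carrier (poly_ring V). eval_mpoly x f = 0} (poly_ring V)"
  unfolding ideal_poly_ring_iff
  by (auto intro: poly_ring_closed simp: eval.hom_mult eval.hom_add)


section \<open>The Nullstellensatz over the complex numbers\<close>

text \<open>Zorn: an ideal that contains no power of \<open>f\<close> can be enlarged to a maximal one with this
  property. The last clause is what maximality means for elements; it says that every \<open>a\<close> outside of
  \<open>P\<close> becomes a unit in \<open>R/P\<close> localised at \<open>f\<close>.\<close>

lemma maximal_ideal_avoiding_powers:
  fixes f :: "('v, 'a::comm_ring_1) mpoly"
  assumes I: "ideal I (poly_ring V)" and f: "f \<in> carrier (poly_ring V)"
    and nrad: "f \<notin> radical (poly_ring V) I"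
  obtains P where "ideal P (poly_ring V)" "I \<subseteq> P" "\<And>n. f ^ n \<notin> P"
    "\<And>a. a \<in> carrier (poly_ring V) \<Longrightarrow> a \<notin> P
       \<Longrightarrow> \<exists>n. \<exists>h\<in>carrier (poly_ring V). f ^ n - h * a \<in> P"
proof -
  define \<A> where "\<A> = {J. ideal J (poly_ring V) \<and> I \<subseteq> J \<and> (\<forall>n. f ^ n \<notin> J)}"
  have "f ^ n \<notin> I" for n
  proof
    assume "f ^ n \<in> I"
    then have "f ^ Suc n \<in> I" using ideal_poly_ringD(4)[OF I f] by simp
    then show False using nrad f unfolding radical_poly_ring by force
  qed
  then have ne: "\<A> \<noteq> {}" using I by (auto simp: \<A>_def)
  have chain: "\<Union>\<C> \<in> \<A>" if \<C>: "\<C> \<noteq> {}" "subset.chain \<A> \<C>" for \<C>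
  proof -
    have mem: "J \<in> \<A>" if "J \<in> \<C>" for J using \<C>(2) that by (auto simp: subset.chain_def)
    have add: "a + b \<in> \<Union>\<C>" if "a \<in> \<Union>\<C>" "b \<in> \<Union>\<C>" for a b
    proof -
      from that obtain J K where JK: "a \<in> J" "J \<in> \<C>" "b \<in> K" "K \<in> \<C>" by auto
      then have "J \<subseteq> K \<or> K \<subseteq> J" using \<C>(2) by (auto simp: subset.chain_def)
      then obtain L where "L \<in> \<C>" "a \<in> L" "b \<in> L" using JK by blast
      then show ?thesis using mem[of L] ideal_poly_ringD(3)[of L V] by (auto simp: \<A>_def)
    qed
    have idJ: "ideal J (poly_ring V)" "I \<subseteq> J" "\<And>n. f ^ n \<notin> J" if "J \<in> \<C>" for J
      using mem[OF that] by (auto simp: \<A>_def)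
    obtain J where J: "J \<in> \<C>" using \<C>(1) by auto
    have "ideal (\<Union>\<C>) (poly_ring V)"
      unfolding ideal_poly_ring_iff
    proof (intro conjI ballI)
      show "\<Union>\<C> \<subseteq> carrier (poly_ring V)" using ideal_poly_ringD(1)[OF idJ(1)] by blast
      show "0 \<in> \<Union>\<C>" using ideal_poly_ringD(2)[OF idJ(1)[OF J]] J by blast
      show "r * a \<in> \<Union>\<C>" if "r \<in> carrier (poly_ring V)" "a \<in> \<Union>\<C>" for r a
        using ideal_poly_ringD(4)[OF idJ(1) that(1)] that(2) by blast
    qed (rule add)
    then show ?thesis using idJ(2)[OF J] idJ(3) J by (auto simp: \<A>_def)
  qed
  obtain P where P: "P \<in> \<A>" and max: "\<And>J. J \<in> \<A> \<Longrightarrow> P \<subseteq> J \<Longrightarrow> J = P"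
    using subset_Zorn_nonempty[OF ne chain] by blast
  have idP: "ideal P (poly_ring V)" using P by (simp add: \<A>_def)
  note PD = ideal_poly_ringD[OF idP]
  show thesis
  proof (rule that[of P])
    fix a assume a: "a \<in> carrier (poly_ring V)" "a \<notin> P"
    define J where "J = {p + h * a | p h. p \<in> P \<and> h \<in> carrier (poly_ring V)}"
    have "ideal J (poly_ring V)"
      unfolding ideal_poly_ring_iff
    proof (intro conjI ballI)
      show "J \<subseteq> carrier (poly_ring V)"
        using PD(1) a by (auto simp: J_def intro!: poly_ring_closed(4,5))
      show "0 \<in> J" using PD(2) poly_ring_closed(1)[of V] by (force simp: J_def)
    next
      fix b c assume "b \<in> J" "c \<in> J"
      then obtain p h q k where "b = p + h * a" "c = q + k * a" "p \<in> P" "q \<in> P"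
        "h \<in> carrier (poly_ring V)" "k \<in> carrier (poly_ring V)" by (auto simp: J_def)
      then have "b + c = (p + q) + (h + k) * a" "p + q \<in> P" "h + k \<in> carrier (poly_ring V)"
        using PD(3) poly_ring_closed(4) by (auto simp: algebra_simps)
      then show "b + c \<in> J" by (auto simp: J_def)
    next
      fix r b :: "('v, 'a) mpoly"
      assume r: "r \<in> carrier (poly_ring V)" and "b \<in> J"
      then obtain p h where "b = p + h * a" "p \<in> P" "h \<in> carrier (poly_ring V)"
        by (auto simp: J_def)
      then have "r * b = r * p + (r * h) * a" "r * p \<in> P" "r * h \<in> carrier (poly_ring V)"
        by (auto simp: distrib_left mult.assoc intro: PD(4) poly_ring_closed(5) r)
      then show "r * b \<in> J" by (auto simp: J_def)
    qed
    moreover have PJ: "P \<subseteq> J"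
    proof
      fix p assume "p \<in> P"
      then have "p = p + 0 * a" "p \<in> P" "0 \<in> carrier (poly_ring V)"
        by (simp_all add: poly_ring_closed(1))
      then show "p \<in> J" unfolding J_def by blast
    qed
    moreover have "a \<in> J"
    proof -
      have "a = 0 + 1 * a" "1 \<in> carrier (poly_ring V)" by (simp_all add: poly_ring_closed)
      then show ?thesis unfolding J_def using PD(2) by blast
    qed
    ultimately have "J \<notin> \<A>" using max a by blast
    then obtain n where "f ^ n \<in> J"
      using \<open>ideal J (poly_ring V)\<close> PJ P by (auto simp: \<A>_def)
    then obtain p h where "f ^ n = p + h * a" "p \<in> P" "h \<in> carrier (poly_ring V)"
      by (auto simp: J_def)
    then show "\<exists>n. \<exists>h\<in>carrier (poly_ring V). f ^ n - h * a \<in> P"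
      by (intro exI[of _ n] bexI[of _ h]) auto
  qed (use P in \<open>auto simp: \<A>_def\<close>)
qed

text \<open>Gaussian elimination, one coordinate \<open>m\<close> at a time.\<close>

lemma linear_dependence:
  fixes h :: "'i \<Rightarrow> 'j \<Rightarrow> 'a::field"
  assumes "finite M" "finite A" "card M < card A"
  shows "\<exists>c. (\<exists>a\<in>A. c a \<noteq> 0) \<and> (\<forall>m\<in>M. (\<Sum>a\<in>A. c a * h a m) = 0)"
  using assms
proof (induction M arbitrary: A h rule: finite_induct)
  case empty
  then obtain a where "a \<in> A" by fastforce
  then show ?case by (intro exI[of _ "\<lambda>_. 1"]) auto
next
  case (insert m M)
  show ?case
  proof (cases "\<forall>a\<in>A. h a m = 0")
    case True
    obtain c where "\<exists>a\<in>A. c a \<noteq> 0" "\<forall>m\<in>M. (\<Sum>a\<in>A. c a * h a m) = 0"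
      using insert.IH[of A h] insert.prems insert.hyps by auto
    then show ?thesis using True by (intro exI[of _ c]) auto
  next
    case False
    then obtain z where z: "z \<in> A" "h z m \<noteq> 0" by auto
    define g where "g a l = h a l - h a m / h z m * h z l" for a l
    have "card M < card (A - {z})" using insert z by simp
    then obtain c where c: "\<exists>a\<in>A - {z}. c a \<noteq> 0" "\<forall>l\<in>M. (\<Sum>a\<in>A - {z}. c a * g a l) = 0"
      using insert.IH[of "A - {z}" g] insert.prems by auto
    define c' where "c' = c(z := - (\<Sum>a\<in>A - {z}. c a * (h a m / h z m)))"
    have key: "(\<Sum>a\<in>A. c' a * h a l) = (\<Sum>a\<in>A - {z}. c a * g a l)" for l
    proof -
      have "(\<Sum>a\<in>A. c' a * h a l) = c' z * h z l + (\<Sum>a\<in>A - {z}. c' a * h a l)"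
        using z insert.prems by (simp add: sum.remove)
      also have "(\<Sum>a\<in>A - {z}. c' a * h a l) = (\<Sum>a\<in>A - {z}. c a * h a l)"
        by (rule sum.cong) (auto simp: c'_def)
      also have "c' z * h z l = - (\<Sum>a\<in>A - {z}. c a * (h a m / h z m * h z l))"
        by (simp add: c'_def sum_distrib_right mult.assoc)
      finally show ?thesis by (simp add: g_def right_diff_distrib sum_subtractf)
    qed
    have "(\<Sum>a\<in>A. c' a * h a l) = 0" if "l \<in> insert m M" for l
    proof (cases "l = m")
      case True
      then show ?thesis unfolding key using z by (simp add: g_def)
    next
      case False
      then show ?thesis unfolding key using c that by simp
    qed
    moreover have "\<exists>a\<in>A. c' a \<noteq> 0" using c(1) by (auto simp: c'_def)
    ultimately show ?thesis by (intro exI[of _ c']) auto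
  qed
qed

definition poly_in :: "'v \<Rightarrow> 'a::comm_ring_1 poly \<Rightarrow> ('v, 'a) mpoly" where
  "poly_in v q = poly (map_poly (Poly_Mapping.single 0) q) (indet v)"

lemma poly_in_pCons: "poly_in v (pCons c q) = Poly_Mapping.single 0 c + indet v * poly_in v q"
  by (simp add: poly_in_def map_poly_pCons)

lemma poly_in_0: "poly_in v 0 = 0"
  by (simp add: poly_in_def)

lemma poly_in_add: "poly_in v (p + q) = poly_in v p + poly_in v q"
  by (induction p q rule: poly_induct2) (auto simp: poly_in_pCons poly_in_0 single_add algebra_simps)

lemma poly_in_smult: "poly_in v (smult c q) = Poly_Mapping.single 0 c * poly_in v q"
  by (induction q) (auto simp: poly_in_pCons poly_in_0 mult_single algebra_simps)

lemma poly_in_mult: "poly_in v (p * q) = poly_in v p * poly_in v q"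
  by (induction p) (auto simp: poly_in_pCons poly_in_0 poly_in_add poly_in_smult algebra_simps)

lemma poly_in_1: "poly_in v 1 = 1"
  by (simp add: one_pCons poly_in_pCons poly_in_0)

lemma poly_in_linear: "poly_in v [:- a, 1:] = indet v - Poly_Mapping.single 0 a"
  by (simp add: poly_in_pCons poly_in_0 single_uminus)

lemma poly_in_sum: "poly_in v (sum g A) = (\<Sum>a\<in>A. poly_in v (g a))"
  by (induction A rule: infinite_finite_induct) (auto simp: poly_in_add poly_in_0)

lemma poly_in_prod: "poly_in v (prod g A) = (\<Prod>a\<in>A. poly_in v (g a))"
  by (induction A rule: infinite_finite_induct) (auto simp: poly_in_mult poly_in_1)

lemma poly_in_closed: "v \<in> V \<Longrightarrow> poly_in v q \<in> carrier (poly_ring V)"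
  by (induction q)
    (auto simp: poly_in_pCons poly_in_0 intro!: poly_ring_closed const_closed_poly_ring indet_closed_poly_ring)

lemma poly_ring_induct [consumes 1, case_names const indet add mult]:
  fixes g :: "('v, 'a::comm_ring_1) mpoly"
  assumes g: "g \<in> carrier (poly_ring V)"
    and const: "\<And>c. Q (Poly_Mapping.single 0 c)"
    and indet: "\<And>v. v \<in> V \<Longrightarrow> Q (indet v)"
    and add: "\<And>p q. p \<in> carrier (poly_ring V) \<Longrightarrow> q \<in> carrier (poly_ring V)
      \<Longrightarrow> Q p \<Longrightarrow> Q q \<Longrightarrow> Q (p + q)"
    and mult: "\<And>p q. p \<in> carrier (poly_ring V) \<Longrightarrow> q \<in> carrier (poly_ring V)
      \<Longrightarrow> Q p \<Longrightarrow> Q q \<Longrightarrow> Q (p * q)"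
  shows "Q g"
proof -
  let ?Q = "\<lambda>p. p \<in> carrier (poly_ring V) \<and> Q p"
  have Q01: "?Q 0" "?Q 1"
    using const[of 0] const[of 1] by (simp_all add: poly_ring_closed)
  have pow: "?Q (indet v ^ n)" if "v \<in> V" for v n
    by (induction n)
      (auto simp: Q01 intro: mult indet that indet_closed_poly_ring poly_ring_closed(5))
  have single: "Poly_Mapping.single (Poly_Mapping.single v n) 1 = (indet v ^ n :: ('v, 'a) mpoly)" for v n
  proof (induction n)
    case (Suc n)
    have "(indet v ^ Suc n :: ('v, 'a) mpoly) = indet v * Poly_Mapping.single (Poly_Mapping.single v n) 1"
      using Suc by simp
    also have "\<dots> = Poly_Mapping.single (Poly_Mapping.single v (Suc n)) 1"
      by (simp add: indet_def mult_single flip: single_add)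
    finally show ?case by simp
  qed simp
  have sum: "?Q (Poly_Mapping.single (\<Sum>v\<in>A. Poly_Mapping.single v (k v)) 1)"
    if "finite A" "A \<subseteq> V" for A and k :: "_ \<Rightarrow> nat"
    using that
  proof (induction A rule: finite_induct)
    case empty
    then show ?case using Q01 by simp
  next
    case (insert v A)
    then have "Poly_Mapping.single (\<Sum>v\<in>insert v A. Poly_Mapping.single v (k v)) 1 =
      (indet v ^ k v :: ('v, 'a) mpoly) * Poly_Mapping.single (\<Sum>v\<in>A. Poly_Mapping.single v (k v)) 1"
      by (simp add: mult_single flip: single)
    then show ?case
      using insert pow[of v "k v"] by (auto intro: mult poly_ring_closed(5))
  qed
  have monom: "?Q (Poly_Mapping.single m c)" if "Poly_Mapping.keys m \<subseteq> V" for m c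
  proof -
    have "Poly_Mapping.single m c = Poly_Mapping.single 0 c * Poly_Mapping.single m 1"
      by (simp add: mult_single)
    moreover have "?Q (Poly_Mapping.single m 1)"
      using sum[OF finite_keys that, of "Poly_Mapping.lookup m"] mpoly_sum_singles[of m] by simp
    ultimately show ?thesis by (simp add: mult const const_closed_poly_ring poly_ring_closed(5))
  qed
  have "?Q (\<Sum>m\<in>A. Poly_Mapping.single m (k m))" if "finite A" "\<forall>m\<in>A. Poly_Mapping.keys m \<subseteq> V" for A k
    using that
    by (induction A rule: finite_induct) (auto simp: Q01 monom intro: add poly_ring_closed(4))
  from this[OF finite_keys, of g "Poly_Mapping.lookup g"] show ?thesis
    using g mpoly_sum_singles[of g] by (simp add: poly_ring_simps(1))
qed

lemma lookup_const_mult: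
  "Poly_Mapping.lookup (Poly_Mapping.single 0 c * p) m = c * Poly_Mapping.lookup (p :: ('v, 'a::comm_ring_1) mpoly) m"
  by (simp add: Poly_Mapping.map.rep_eq when_def flip: mult_map_scale_conv_mult)

lemma finite_bounded_monomials:
  assumes "finite V"
  shows "finite {m :: 'v \<Rightarrow>\<^sub>0 nat. Poly_Mapping.keys m \<subseteq> V \<and> (\<forall>v. Poly_Mapping.lookup m v \<le> N)}"
    (is "finite ?M")
proof (rule finite_imageD)
  have "Poly_Mapping.lookup ` ?M
      \<subseteq> {k. \<forall>v. (v \<in> V \<longrightarrow> k v \<in> {..N}) \<and> (v \<notin> V \<longrightarrow> k v = 0)}"
    by (auto simp: subset_iff in_keys_iff)
  then show "finite (Poly_Mapping.lookup ` ?M)"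
    using finite_set_of_finite_funs[OF assms, of "{..N}" 0] finite_subset by auto
  show "inj_on Poly_Mapping.lookup ?M"
    by (auto intro!: inj_onI poly_mapping_eqI)
qed

lemma exponents_bounded:
  obtains N where "\<And>m v. m \<in> Poly_Mapping.keys p \<Longrightarrow> Poly_Mapping.lookup m v \<le> (N::nat)"
proof -
  let ?E = "insert 0 (\<Union>m\<in>Poly_Mapping.keys p. Poly_Mapping.lookup m ` Poly_Mapping.keys m)"
  have "Poly_Mapping.lookup m v \<le> Max ?E" if "m \<in> Poly_Mapping.keys p" for m v
  proof (rule Max_ge)
    show "finite ?E" by auto
    show "Poly_Mapping.lookup m v \<in> ?E"
    proof (cases "v \<in> Poly_Mapping.keys m")
      case True
      then show ?thesis using that by blast
    qed (simp add: in_keys_iff)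
  qed
  then show thesis by (rule that)
qed

text \<open>Over \<open>\<complex>\<close> the polynomial \<open>q\<close> splits into linear factors, and a prime ideal that contains their
  product contains one of them.\<close>

lemma poly_in_root_in_prime:
  fixes q :: "complex poly"
  assumes P: "ideal P (poly_ring V)" and one: "1 \<notin> P" and v: "v \<in> V"
    and prime: "\<And>a b. a \<in> carrier (poly_ring V) \<Longrightarrow> b \<in> carrier (poly_ring V)
      \<Longrightarrow> a * b \<in> P \<Longrightarrow> a \<in> P \<or> b \<in> P"
    and "q \<noteq> 0" "poly_in v q \<in> P"
  shows "\<exists>a. indet v - Poly_Mapping.single 0 a \<in> P"
  using assms(5,6)
proof (induction "degree q" arbitrary: q)
  case 0
  then obtain c where q: "q = [:c:]" "c \<noteq> 0" by (metis degree_eq_zeroE pCons_0_0)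
  then have "Poly_Mapping.single 0 c \<in> P" using 0 by (simp add: poly_in_pCons poly_in_0)
  then have "Poly_Mapping.single 0 (1 / c) * Poly_Mapping.single 0 c \<in> P"
    by (intro ideal_poly_ringD(4)[OF P] const_closed_poly_ring)
  then show ?case using one q by (simp add: mult_single)
next
  case (Suc n)
  then have "\<not> constant (poly q)" by (simp add: constant_degree)
  then obtain b where "poly q b = 0" using fundamental_theorem_of_algebra by blast
  then obtain r where r: "q = [:- b, 1:] * r" by (metis poly_eq_0_iff_dvd dvdE)
  have "indet v - Poly_Mapping.single 0 b \<in> P \<or> poly_in v r \<in> P"
  proof (rule prime)
    show "(indet v - Poly_Mapping.single 0 b) * poly_in v r \<in> P"
      using Suc.prems(2) unfolding r poly_in_mult poly_in_linear .
  qed (use v in \<open>auto intro: diff_closed_poly_ring indet_closed_poly_ring const_closed_poly_ring poly_in_closed\<close>)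
  moreover have "r \<noteq> 0" using Suc.prems r by auto
  moreover have "degree r = n" using Suc.hyps(2) \<open>r \<noteq> 0\<close> unfolding r by (subst (asm) degree_mult_eq) auto
  ultimately show ?case using Suc.hyps(1) by auto
qed

text \<open>If no linear polynomial \<open>v - a\<close> lies in \<open>P\<close>, each of them divides a power \<open>f ^ n a\<close> modulo \<open>P\<close>,
  say with cofactor \<open>h a\<close>. As \<open>\<complex>\<close> is uncountable, infinitely many \<open>a\<close> share the exponent \<open>n a = e\<close>
  and a bound on the exponents of \<open>h a\<close>, so that finitely many of these \<open>h a\<close> are linearly dependent.
  Multiplying the relation \<open>\<Sum>a. c a * h a = 0\<close> by the product of all \<open>v - a\<close> turns it into
  \<open>f ^ e * q \<in> P\<close> for the polynomial \<open>q = \<Sum>a. c a * (\<Prod>b \<noteq> a. v - b)\<close> in the single indeterminate \<open>v\<close>,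
  which is nonzero by Lagrange interpolation. Since \<open>P\<close> is prime, by maximality, and avoids the
  powers of \<open>f\<close>, it contains \<open>q\<close> and hence a linear factor of \<open>q\<close>.\<close>

lemma exists_coordinate:
  fixes P :: "('v, complex) mpoly set"
  assumes V: "finite V" and v: "v \<in> V" and P: "ideal P (poly_ring V)"
    and f: "f \<in> carrier (poly_ring V)" "\<And>n. f ^ n \<notin> P"
    and unit: "\<And>a. a \<in> carrier (poly_ring V) \<Longrightarrow> a \<notin> P
       \<Longrightarrow> \<exists>n. \<exists>h\<in>carrier (poly_ring V). f ^ n - h * a \<in> P"
  shows "\<exists>a. indet v - Poly_Mapping.single 0 a \<in> P"
proof (rule ccontr)
  assume none: "\<nexists>a. indet v - Poly_Mapping.single 0 a \<in> P"
  note PD = ideal_poly_ringD[OF P]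
  note closed = poly_ring_closed pow_closed_poly_ring diff_closed_poly_ring
    const_closed_poly_ring indet_closed_poly_ring
  have prime: "a \<in> P \<or> b \<in> P"
    if ab: "a \<in> carrier (poly_ring V)" "b \<in> carrier (poly_ring V)" "a * b \<in> P" for a b
  proof (rule ccontr)
    assume "\<not> (a \<in> P \<or> b \<in> P)"
    then obtain n h m k where h: "h \<in> carrier (poly_ring V)" "f ^ n - h * a \<in> P"
      and k: "k \<in> carrier (poly_ring V)" "f ^ m - k * b \<in> P"
      using unit[OF ab(1)] unit[OF ab(2)] by blast
    have "f ^ m * (f ^ n - h * a) + (h * a) * (f ^ m - k * b) + (h * k) * (a * b) \<in> P"
      by (intro PD(3,4) closed f h k ab)
    moreover have "f ^ m * (f ^ n - h * a) + (h * a) * (f ^ m - k * b) + (h * k) * (a * b) = f ^ (n + m)"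
      by (simp add: algebra_simps power_add)
    ultimately show False using f(2) by metis
  qed
  define L where "L a = indet v - Poly_Mapping.single 0 a" for a :: complex
  have L: "L a \<in> carrier (poly_ring V)" "L a \<notin> P" for a
    using none v by (auto simp: L_def intro: closed)
  have "\<exists>n h N. h \<in> carrier (poly_ring V) \<and> f ^ n - h * L a \<in> P \<and>
      (\<forall>m\<in>Poly_Mapping.keys h. \<forall>u. Poly_Mapping.lookup m u \<le> N)" for a
    using unit[OF L, of a] exponents_bounded by metis
  then obtain n h N where h: "\<And>a. h a \<in> carrier (poly_ring V)" "\<And>a. f ^ n a - h a * L a \<in> P"
    and N: "\<And>a m u. m \<in> Poly_Mapping.keys (h a) \<Longrightarrow> Poly_Mapping.lookup m u \<le> N a"
    by metis
  \<comment> \<open>Uncountably many points, but only countably many pairs of an exponent and a bound.\<close>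
  obtain e D where inf: "infinite {r::real. n (of_real r) = e \<and> N (of_real r) = D}"
  proof -
    have "\<exists>k. infinite {r::real. (n (of_real r), N (of_real r)) = k}"
    proof (rule ccontr)
      assume "\<nexists>k. infinite {r::real. (n (of_real r), N (of_real r)) = k}"
      then have "countable (\<Union>k. {r::real. (n (of_real r), N (of_real r)) = k})"
        by (intro countable_UN) (auto intro: countable_finite)
      moreover have "(\<Union>k. {r::real. (n (of_real r), N (of_real r)) = k}) = UNIV" by auto
      ultimately show False using uncountable_UNIV_real by simp
    qed
    then show thesis using that by (auto simp: prod_eq_iff)
  qed
  define M where "M = {m :: 'v \<Rightarrow>\<^sub>0 nat. Poly_Mapping.keys m \<subseteq> V \<and> (\<forall>u. Poly_Mapping.lookup m u \<le> D)}"
  have M: "finite M" unfolding M_def by (rule finite_bounded_monomials[OF V])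
  obtain R where R: "finite R" "card R = Suc (card M)"
    "R \<subseteq> {r::real. n (of_real r) = e \<and> N (of_real r) = D}"
    using infinite_arbitrarily_large[OF inf] by blast
  define A where "A = complex_of_real ` R"
  have A: "finite A" "card M < card A" "\<And>a. a \<in> A \<Longrightarrow> n a = e" "\<And>a. a \<in> A \<Longrightarrow> N a = D"
    using R by (auto simp: A_def card_image inj_on_def)
  obtain c z where z: "z \<in> A" "c z \<noteq> 0"
    and c: "\<And>m. m \<in> M \<Longrightarrow> (\<Sum>a\<in>A. c a * Poly_Mapping.lookup (h a) m) = 0"
    using linear_dependence[OF M A(1,2), of "\<lambda>a. Poly_Mapping.lookup (h a)"] by blast
  have ch: "(\<Sum>a\<in>A. Poly_Mapping.single 0 (c a) * h a) = 0"
  proof (rule poly_mapping_eqI)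
    fix m
    have "(\<Sum>a\<in>A. c a * Poly_Mapping.lookup (h a) m) = 0"
    proof (cases "m \<in> M")
      case False
      have "Poly_Mapping.lookup (h a) m = 0" if "a \<in> A" for a
      proof (rule ccontr)
        assume "Poly_Mapping.lookup (h a) m \<noteq> 0"
        then have "m \<in> Poly_Mapping.keys (h a)" by (simp add: in_keys_iff)
        then have "m \<in> M"
          using N[of m a] A(4)[OF that] h(1)[of a] by (auto simp: M_def poly_ring_simps(1))
        with False show False ..
      qed
      then show ?thesis by simp
    qed (rule c)
    then show "Poly_Mapping.lookup (\<Sum>a\<in>A. Poly_Mapping.single 0 (c a) * h a) m
        = Poly_Mapping.lookup 0 m"
      by (simp add: lookup_sum lookup_const_mult)
  qed
  define q where "q = (\<Sum>a\<in>A. smult (c a) (\<Prod>b\<in>A - {a}. [:- b, 1:]))"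
  \<comment> \<open>At the node \<open>z\<close> only the summand of \<open>z\<close> survives.\<close>
  have "poly q z = (\<Sum>a\<in>A. if a = z then c z * (\<Prod>b\<in>A - {z}. z - b) else 0)"
    unfolding q_def poly_sum
  proof (rule sum.cong)
    fix a assume a: "a \<in> A"
    show "poly (smult (c a) (\<Prod>b\<in>A - {a}. [:- b, 1:])) z
        = (if a = z then c z * (\<Prod>b\<in>A - {z}. z - b) else 0)"
      using A(1) z(1) by (auto simp: poly_prod)
  qed simp
  also have "\<dots> = c z * (\<Prod>b\<in>A - {z}. z - b)" using A(1) z(1) by simp
  also have "\<dots> \<noteq> 0" using z A(1) by simp
  finally have q0: "q \<noteq> 0" by auto
  let ?C = "\<lambda>a. Poly_Mapping.single 0 (c a)"
  let ?g = "\<lambda>a. \<Prod>b\<in>A - {a}. L b"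
  have pq: "poly_in v q = (\<Sum>a\<in>A. ?C a * ?g a)"
    by (simp add: q_def L_def poly_in_sum poly_in_smult poly_in_prod poly_in_linear)
  have "(\<Sum>a\<in>A. (?C a * ?g a) * (f ^ n a - h a * L a)) \<in> P"
    by (intro ideal_poly_ring_sum[OF P] PD(4) closed h prod_closed_poly_ring L)
  also have "(\<Sum>a\<in>A. (?C a * ?g a) * (f ^ n a - h a * L a))
      = (\<Sum>a\<in>A. f ^ e * (?C a * ?g a) - (\<Prod>b\<in>A. L b) * (?C a * h a))"
  proof (rule sum.cong)
    fix a assume a: "a \<in> A"
    then have "(\<Prod>b\<in>A. L b) = L a * ?g a" using A(1) by (simp add: prod.remove)
    then show "(?C a * ?g a) * (f ^ n a - h a * L a)
        = f ^ e * (?C a * ?g a) - (\<Prod>b\<in>A. L b) * (?C a * h a)"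
      using A(3)[OF a] by (simp add: algebra_simps)
  qed simp
  also have "\<dots> = f ^ e * poly_in v q"
    using ch by (simp add: sum_subtractf pq flip: sum_distrib_left)
  finally have "f ^ e \<in> P \<or> poly_in v q \<in> P"
    by (rule prime[OF pow_closed_poly_ring[OF f(1)] poly_in_closed[OF v]])
  then have "poly_in v q \<in> P" using f(2) by blast
  then show False
    using poly_in_root_in_prime[OF P _ v prime q0] none f(2)[of 0] by auto
qed

text \<open>The ideal \<open>P\<close> contains \<open>v - x v\<close> for every indeterminate \<open>v\<close>, so modulo \<open>P\<close> every polynomial
  equals its value at \<open>x\<close>; members of \<open>P\<close> therefore vanish at \<open>x\<close>, whereas \<open>f\<close> does not.\<close>

theorem nullstellensatz:
  fixes f :: "('v, complex) mpoly"
  assumes V: "finite V" and I: "ideal I (poly_ring V)" and f: "f \<in> carrier (poly_ring V)"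
    and nrad: "f \<notin> radical (poly_ring V) I"
  obtains x where "\<And>g. g \<in> I \<Longrightarrow> eval_mpoly x g = 0" "eval_mpoly x f \<noteq> 0"
proof -
  obtain P where P: "ideal P (poly_ring V)" "I \<subseteq> P" and fP: "\<And>n. f ^ n \<notin> P"
    and unit: "\<And>a. a \<in> carrier (poly_ring V) \<Longrightarrow> a \<notin> P
       \<Longrightarrow> \<exists>n. \<exists>h\<in>carrier (poly_ring V). f ^ n - h * a \<in> P"
    using maximal_ideal_avoiding_powers[OF I f nrad] by metis
  obtain x where x: "\<And>v. v \<in> V \<Longrightarrow> indet v - Poly_Mapping.single 0 (x v) \<in> P"
    using exists_coordinate[OF V _ P(1) f fP unit] by metis
  note PD = ideal_poly_ringD[OF P(1)]
  have cong: "g - Poly_Mapping.single 0 (eval_mpoly x g) \<in> P" if "g \<in> carrier (poly_ring V)" for g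
    using that
  proof (induction g rule: poly_ring_induct)
    case (const c)
    then show ?case using PD(2) by (simp add: eval_mpoly_const)
  next
    case (indet v)
    then show ?case using x by (simp add: eval_mpoly_indet)
  next
    case (add p q)
    then show ?case
      using PD(3)[OF add(3,4)] by (simp add: eval_mpoly_add single_add algebra_simps)
  next
    case (mult p q)
    let ?E = "\<lambda>p. Poly_Mapping.single 0 (eval_mpoly x p)"
    have "q * (p - ?E p) + ?E p * (q - ?E q) \<in> P"
      by (intro PD(3,4) mult const_closed_poly_ring)
    also have "q * (p - ?E p) + ?E p * (q - ?E q) = p * q - ?E (p * q)"
      by (simp add: algebra_simps eval_mpoly_mult mult_single)
    finally show ?case .
  qed
  show thesis
  proof (rule that)
    fix g assume "g \<in> I"
    then have "g \<in> P" using P(2) by auto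
    then have "Poly_Mapping.single 0 (eval_mpoly x g) \<in> P"
      using PD(6)[OF _ cong, of g g] PD(1) by auto
    then have "Poly_Mapping.single 0 (1 / eval_mpoly x g) * Poly_Mapping.single 0 (eval_mpoly x g) \<in> P"
      by (intro PD(4) const_closed_poly_ring)
    then show "eval_mpoly x g = 0" using fP[of 0] by (cases "eval_mpoly x g = 0") (auto simp: mult_single)
  next
    show "eval_mpoly x f \<noteq> 0" using cong[OF f] fP[of 1] by auto
  qed
qed


section \<open>Minors with arbitrary sequences of rows and columns\<close>

text \<open>Rows and columns are given by arbitrary sequences. Repetitions and permutations cost nothing
  (the determinant becomes 0 or changes its sign), and replacing or adjoining a single row or column
  becomes a function update, whereas the index sets of a submatrix would have to be sorted again.\<close>

definition subdet :: "('r \<Rightarrow> 'c \<Rightarrow> 'a::comm_ring_1) \<Rightarrow> nat \<Rightarrow> (nat \<Rightarrow> 'r) \<Rightarrow> (nat \<Rightarrow> 'c) \<Rightarrow> 'a" where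
  "subdet a r f g = det (mat r r (\<lambda>(i, j). a (f i) (g j)))"

lemma subdet_0: "subdet a 0 f g = 1"
  by (simp add: subdet_def)

lemma subdet_cong:
  assumes "\<And>i j. i < r \<Longrightarrow> j < r \<Longrightarrow> a (f i) (g j) = b (f' i) (g' j)"
  shows "subdet a r f g = subdet b r f' g'"
  unfolding subdet_def by (rule arg_cong[of _ _ det], rule eq_matI) (use assms in auto)

lemma subdet_transpose: "subdet (\<lambda>i j. a j i) r g f = subdet a r f g"
proof -
  let ?M = "mat r r (\<lambda>(i, j). a (f i) (g j))"
  have "mat r r (\<lambda>(i, j). a (f j) (g i)) = transpose_mat ?M"
    by (rule eq_matI) auto
  then show ?thesis
    using det_transpose[of ?M r] by (simp add: subdet_def)
qed

lemma subdet_equal_columns: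
  assumes "p < r" "q < r" "p \<noteq> q" "\<And>i. i < r \<Longrightarrow> a (f i) (g p) = a (f i) (g q)"
  shows "subdet a r f g = 0"
  unfolding subdet_def
  by (rule det_identical_columns[OF _ assms(3,1,2)]) (use assms in \<open>auto intro!: eq_vecI\<close>)

lemma subdet_equal_rows:
  assumes "p < r" "q < r" "p \<noteq> q" "f p = f q"
  shows "subdet a r f g = 0"
  unfolding subdet_transpose[of a, symmetric]
  by (rule subdet_equal_columns[OF assms(1-3)]) (simp add: assms)

lemma subdet_expand_column:
  assumes "p < Suc r"
  shows "subdet a (Suc r) f g = (\<Sum>i<Suc r. a (f i) (g p) *
    ((-1) ^ (i + p) * subdet a r (f \<circ> insert_index i) (g \<circ> insert_index p)))"
proof -
  let ?M = "mat (Suc r) (Suc r) (\<lambda>(i, j). a (f i) (g j))"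
  have "subdet a (Suc r) f g = (\<Sum>i<Suc r. ?M $$ (i, p) * cofactor ?M i p)"
    unfolding subdet_def by (rule laplace_expansion_column[OF _ assms]) simp
  also have "\<dots> = (\<Sum>i<Suc r. a (f i) (g p) *
    ((-1) ^ (i + p) * subdet a r (f \<circ> insert_index i) (g \<circ> insert_index p)))"
  proof (rule sum.cong)
    fix i assume i: "i \<in> {..<Suc r}"
    have "mat_delete ?M i p
        = mat r r (\<lambda>(i', j'). a ((f \<circ> insert_index i) i') ((g \<circ> insert_index p) j'))"
      by (rule eq_matI) (auto simp: mat_delete_def insert_index_def)
    then show "?M $$ (i, p) * cofactor ?M i p = a (f i) (g p) *
      ((-1) ^ (i + p) * subdet a r (f \<circ> insert_index i) (g \<circ> insert_index p))"
      using i assms by (simp add: cofactor_def subdet_def)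
  qed simp
  finally show ?thesis .
qed

lemma subdet_expand_row:
  assumes "p < Suc r"
  shows "subdet a (Suc r) f g = (\<Sum>j<Suc r. a (f p) (g j) *
    ((-1) ^ (p + j) * subdet a r (f \<circ> insert_index p) (g \<circ> insert_index j)))"
  using subdet_expand_column[OF assms, of "\<lambda>i j. a j i" g f]
  unfolding subdet_transpose[of a] add.commute[of _ p] .

lemma subdet_zero_column:
  assumes "p < r" "\<And>i. i < r \<Longrightarrow> a (f i) (g p) = 0"
  shows "subdet a r f g = 0"
proof (cases r)
  case (Suc s)
  then show ?thesis using assms subdet_expand_column[of p s a f g] by simp
qed (use assms in simp)

lemma subdet_permute_rows:
  assumes "\<pi> permutes {..<r}"
  shows "subdet a r (f \<circ> \<pi>) g = signof \<pi> * subdet a r f g"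
proof -
  let ?M = "mat r r (\<lambda>(i, j). a (f i) (g j))"
  have \<pi>: "\<pi> permutes {0..<r}" using assms by (simp add: atLeast0LessThan)
  have "mat r r (\<lambda>(i, j). a ((f \<circ> \<pi>) i) (g j)) = mat r r (\<lambda>(i, j). ?M $$ (\<pi> i, j))"
    by (rule eq_matI) (use permutes_in_image[OF assms] in auto)
  then show ?thesis using det_permute_rows[OF _ \<pi>, of ?M] by (simp add: subdet_def)
qed

lemma subdet_permute_columns:
  assumes "\<pi> permutes {..<r}"
  shows "subdet a r f (g \<circ> \<pi>) = signof \<pi> * subdet a r f g"
  using subdet_permute_rows[OF assms, of "\<lambda>i j. a j i" g f] unfolding subdet_transpose[of a] .

lemma (in comm_ring_hom) hom_subdet: "hom (subdet a r f g) = subdet (\<lambda>i j. hom (a i j)) r f g"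
proof -
  have "map_mat hom (mat r r (\<lambda>(i, j). a (f i) (g j))) = mat r r (\<lambda>(i, j). hom (a (f i) (g j)))"
    by (rule eq_matI) auto
  then show ?thesis unfolding subdet_def by (simp only: hom_det[symmetric])
qed

text \<open>The Cauchy--Binet formula degenerates here: padded with zeros, the left factor is a square
  matrix with a zero column.\<close>

lemma subdet_product_eq_0:
  assumes "s < r" and fac: "\<And>i j. i < r \<Longrightarrow> j < r \<Longrightarrow> a (f i) (g j) = (\<Sum>k<s. b i k * c k j)"
  shows "subdet a r f g = (0 :: 'a::comm_ring_1)"
proof -
  define B where "B = mat r r (\<lambda>(i, k). if k < s then b i k else 0)"
  define C where "C = mat r r (\<lambda>(k, j). c k j)"
  have "mat r r (\<lambda>(i, j). a (f i) (g j)) = B * C"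
  proof (rule eq_matI)
    fix i j assume ij: "i < dim_row (B * C)" "j < dim_col (B * C)"
    have "(\<Sum>k = 0..<r. (if k < s then b i k else 0) * c k j) = (\<Sum>k<s. b i k * c k j)"
      by (rule sum.mono_neutral_cong_right) (use \<open>s < r\<close> in auto)
    then show "mat r r (\<lambda>(i, j). a (f i) (g j)) $$ (i, j) = (B * C) $$ (i, j)"
      using ij fac by (simp add: B_def C_def scalar_prod_def)
  qed (auto simp: B_def C_def)
  moreover have "det B = 0"
    using subdet_zero_column[OF \<open>s < r\<close>, of "\<lambda>i k. if k < s then b i k else 0" "\<lambda>i. i" "\<lambda>i. i"]
    by (simp add: B_def subdet_def)
  ultimately show ?thesis
    using det_mult[of B r C] by (simp add: subdet_def B_def C_def)
qed


section \<open>Vanishing minors and rank over a field\<close>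

definition minors_vanish :: "('r \<Rightarrow> 'c \<Rightarrow> 'a::comm_ring_1) \<Rightarrow> 'r set \<Rightarrow> 'c set \<Rightarrow> nat \<Rightarrow> bool" where
  "minors_vanish a R U r \<longleftrightarrow>
     (\<forall>f\<in>{..<r} \<rightarrow> R. \<forall>g\<in>{..<r} \<rightarrow> U. subdet a r f g = 0)"

definition spanned_by :: "('r \<Rightarrow> 'c \<Rightarrow> 'a::comm_ring_1) \<Rightarrow> 'r set \<Rightarrow> nat \<Rightarrow> (nat \<Rightarrow> 'c) \<Rightarrow> 'c \<Rightarrow> bool" where
  "spanned_by a R s g c \<longleftrightarrow> (\<exists>l. \<forall>i\<in>R. a i c = (\<Sum>k<s. a i (g k) * l k))"

lemma minors_vanish_if_spanned:
  assumes "s < r" "\<And>c. c \<in> U \<Longrightarrow> spanned_by a R s g c"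
  shows "minors_vanish a R U r"
  unfolding minors_vanish_def
proof (intro ballI)
  fix f h assume f: "f \<in> {..<r} \<rightarrow> R" and h: "h \<in> {..<r} \<rightarrow> U"
  obtain l where l: "\<And>c i. c \<in> U \<Longrightarrow> i \<in> R \<Longrightarrow> a i c = (\<Sum>k<s. a i (g k) * l c k)"
    using assms(2) unfolding spanned_by_def by metis
  show "subdet a r f h = 0"
    by (rule subdet_product_eq_0[OF assms(1), of _ _ _ "\<lambda>i k. a (f i) (g k)" "\<lambda>k j. l (h j) k"])
      (use f h l in blast)
qed

text \<open>Cramer's rule: the minor bordered by row \<open>i\<close> and column \<open>c\<close> vanishes, and its expansion along
  the new row expresses the entry \<open>a i c\<close> through the entries of row \<open>i\<close> in the columns \<open>g\<close>, with
  coefficients that do not depend on \<open>i\<close>.\<close>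

lemma spanned_by_nonzero_minor:
  fixes a :: "'r \<Rightarrow> 'c \<Rightarrow> 'a::field"
  assumes van: "minors_vanish a R U (Suc s)"
    and f: "f \<in> {..<s} \<rightarrow> R" and g: "g \<in> {..<s} \<rightarrow> U" and nz: "subdet a s f g \<noteq> 0"
    and c: "c \<in> U"
  shows "spanned_by a R s g c"
proof -
  define g' where "g' = g(s := c)"
  define \<kappa> where "\<kappa> j = (-1) ^ (s + j) * subdet a s f (g' \<circ> insert_index j)" for j
  have "subdet a s f (g' \<circ> insert_index s) = subdet a s f g"
    by (rule subdet_cong) (auto simp: g'_def)
  then have \<kappa>s: "\<kappa> s = subdet a s f g" by (simp add: \<kappa>_def flip: mult_2)
  have comb: "a i c = (\<Sum>k<s. a i (g k) * (- \<kappa> k / \<kappa> s))" if i: "i \<in> R" for i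
  proof -
    define f' where "f' = f(s := i)"
    have eq: "subdet a s (f' \<circ> insert_index s) (g' \<circ> insert_index j)
        = subdet a s f (g' \<circ> insert_index j)" for j
      by (rule subdet_cong) (auto simp: f'_def)
    have "f' \<in> {..<Suc s} \<rightarrow> R" "g' \<in> {..<Suc s} \<rightarrow> U"
      using f g i c by (auto simp: f'_def g'_def less_Suc_eq)
    then have "0 = subdet a (Suc s) f' g'" using van by (simp add: minors_vanish_def)
    also have "\<dots> = (\<Sum>j<Suc s. a i (g' j) * \<kappa> j)"
      unfolding subdet_expand_row[OF lessI] eq by (simp add: \<kappa>_def f'_def)
    also have "\<dots> = (\<Sum>k<s. a i (g k) * \<kappa> k) + a i c * \<kappa> s"
      by (simp add: g'_def)
    finally have "a i c = - (\<Sum>k<s. a i (g k) * \<kappa> k) / \<kappa> s"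
      using nz \<kappa>s by (simp add: field_simps eq_neg_iff_add_eq_0)
    also have "\<dots> = (\<Sum>k<s. a i (g k) * (- \<kappa> k / \<kappa> s))"
      by (simp add: sum_divide_distrib sum_negf)
    finally show ?thesis .
  qed
  show ?thesis
    unfolding spanned_by_def by (intro exI[of _ "\<lambda>k. - \<kappa> k / \<kappa> s"] ballI comb)
qed

text \<open>Vanishing of the minors of size \<open>r\<close> means rank below \<open>r\<close>: the columns of a nonzero minor of
  maximal size span all others.\<close>

lemma minors_vanish_spanning_columns:
  fixes a :: "'r \<Rightarrow> 'c \<Rightarrow> 'a::field"
  assumes van: "minors_vanish a R U r"
  obtains s g where "s < r" "g \<in> {..<s} \<rightarrow> U" "\<And>c. c \<in> U \<Longrightarrow> spanned_by a R s g c"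
proof -
  define q where "q = (LEAST q. minors_vanish a R U q)"
  have q: "minors_vanish a R U q" "q \<le> r"
    unfolding q_def by (rule LeastI[of _ r], rule van) (rule Least_le, rule van)
  have "\<not> minors_vanish a R U 0"
    by (simp add: minors_vanish_def subdet_0)
  then have "q \<noteq> 0" using q(1) by metis
  then obtain s where s: "q = Suc s" by (cases q) auto
  then have "\<not> minors_vanish a R U s"
    using not_less_Least[of s "minors_vanish a R U"] by (simp add: q_def)
  then obtain f g where "f \<in> {..<s} \<rightarrow> R" "g \<in> {..<s} \<rightarrow> U" "subdet a s f g \<noteq> 0"
    unfolding minors_vanish_def by blast
  then show thesis
    using that[of s g] spanned_by_nonzero_minor[of a R U s f g] q s by simp
qed

lemma spanned_by_mult:
  assumes "spanned_by a R s g c" "\<And>i. i \<in> R \<Longrightarrow> a i c' = \<mu> * a i c"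
  shows "spanned_by a R s g c'"
proof -
  obtain l where "\<forall>i\<in>R. a i c = (\<Sum>k<s. a i (g k) * l k)"
    using assms(1) by (auto simp: spanned_by_def)
  then have "a i c' = (\<Sum>k<s. a i (g k) * (\<mu> * l k))" if "i \<in> R" for i
    using assms(2) that by (simp add: sum_distrib_left mult_ac)
  then show ?thesis
    unfolding spanned_by_def by (intro exI[of _ "\<lambda>k. \<mu> * l k"] ballI)
qed

lemma minors_vanish_mono:
  "minors_vanish a R U r \<Longrightarrow> V \<subseteq> U \<Longrightarrow> minors_vanish a R V r"
  by (fastforce simp: minors_vanish_def)

text \<open>The columns that span \<open>U\<close> also span all multiples of columns in \<open>U\<close>.\<close>

lemma minors_vanish_multiples:
  fixes a :: "'r \<Rightarrow> 'c \<Rightarrow> 'a::field"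
  assumes "minors_vanish a R U r"
    and mult: "\<And>c. c \<in> V \<Longrightarrow> \<exists>c'\<in>U. \<exists>\<mu>. \<forall>i\<in>R. a i c = \<mu> * a i c'"
  shows "minors_vanish a R V r"
proof -
  obtain s g where s: "s < r" "\<And>c. c \<in> U \<Longrightarrow> spanned_by a R s g c"
    using minors_vanish_spanning_columns[OF assms(1)] by metis
  show ?thesis
  proof (rule minors_vanish_if_spanned[OF s(1)])
    fix c assume "c \<in> V"
    then obtain c' \<mu> where "c' \<in> U" "\<forall>i\<in>R. a i c = \<mu> * a i c'" using mult by blast
    then show "spanned_by a R s g c" by (intro spanned_by_mult[OF s(2), of c' c \<mu>]) auto
  qed
qed

text \<open>The \<open>s\<close> columns of a nonzero minor common to \<open>U\<close> and \<open>V\<close> span both \<open>U\<close> and \<open>V\<close>, hence the union.\<close>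

lemma minors_vanish_union:
  fixes a :: "'r \<Rightarrow> 'c \<Rightarrow> 'a::field"
  assumes "minors_vanish a R U (Suc s)" "minors_vanish a R V (Suc s)"
    and "\<not> minors_vanish a R (U \<inter> V) s"
  shows "minors_vanish a R (U \<union> V) (Suc s)"
proof -
  obtain f g where fg: "f \<in> {..<s} \<rightarrow> R" "g \<in> {..<s} \<rightarrow> U \<inter> V" "subdet a s f g \<noteq> 0"
    using assms(3) by (auto simp: minors_vanish_def)
  then have "g \<in> {..<s} \<rightarrow> U" "g \<in> {..<s} \<rightarrow> V" by auto
  then show ?thesis
    using spanned_by_nonzero_minor[OF assms(1) fg(1) _ fg(3)]
      spanned_by_nonzero_minor[OF assms(2) fg(1) _ fg(3)]
    by (intro minors_vanish_if_spanned[of s _ _ _ _ g]) auto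
qed


section \<open>Minors of the generic matrix in an ideal\<close>

lemma minors_subdet:
  assumes "m \<in> minors r Y"
  obtains f g where "f \<in> {..<r} \<rightarrow> {..<dim_row Y}" "g \<in> {..<r} \<rightarrow> {..<dim_col Y}"
    "m = subdet (\<lambda>i j. Y $$ (i, j)) r f g"
proof -
  obtain I J where IJ: "m = det (submatrix Y I J)"
    "I \<subseteq> {..<dim_row Y}" "card I = r" "J \<subseteq> {..<dim_col Y}" "card J = r"
    using assms by (auto simp: minors_def)
  have "{i. i < dim_row Y \<and> i \<in> I} = I" "{j. j < dim_col Y \<and> j \<in> J} = J" using IJ by auto
  then have "m = subdet (\<lambda>i j. Y $$ (i, j)) r (pick I) (pick J)"
    unfolding IJ(1) subdet_def submatrix_def using IJ by simp
  moreover have "pick I \<in> {..<r} \<rightarrow> {..<dim_row Y}" "pick J \<in> {..<r} \<rightarrow> {..<dim_col Y}"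
    by (intro Pi_I, metis IJ(2,3) pick_in_set_le subsetD lessThan_iff)
      (intro Pi_I, metis IJ(4,5) pick_in_set_le subsetD lessThan_iff)
  ultimately show thesis by (intro that)
qed

text \<open>\<^const>\<open>pick\<close> enumerates a set of naturals increasingly, so \<open>\<pi>\<close> sorts the sequence \<open>f\<close>.\<close>

lemma sorting_permutation:
  assumes inj: "inj_on f {..<r}"
  obtains \<pi> where "\<pi> permutes {..<r}" "\<And>i. i < r \<Longrightarrow> f i = pick (f ` {..<r}) (\<pi> i)"
proof -
  let ?I = "f ` {..<r}"
  have card: "card ?I = r" using inj by (simp add: card_image)
  have inj_pick: "inj_on (pick ?I) {..<r}"
  proof (rule linorder_inj_onI)
    fix i j assume "i < j" "j \<in> {..<r}"
    then show "pick ?I i \<noteq> pick ?I j" using pick_mono_le[of j ?I i] card by simp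
  qed auto
  have "pick ?I ` {..<r} = ?I"
  proof (rule card_subset_eq)
    show "pick ?I ` {..<r} \<subseteq> ?I"
    proof (rule image_subsetI)
      fix i assume "i \<in> {..<r}"
      then show "pick ?I i \<in> ?I" using pick_in_set_le[of i ?I] card by simp
    qed
    show "card (pick ?I ` {..<r}) = card ?I" using inj_pick card by (simp only: card_image card_lessThan)
  qed simp
  with inj_pick have bij: "bij_betw (pick ?I) {..<r} ?I" by (simp add: bij_betw_def)
  define \<pi> where "\<pi> i = (if i < r then inv_into {..<r} (pick ?I) (f i) else i)" for i
  have "bij_betw (inv_into {..<r} (pick ?I) \<circ> f) {..<r} {..<r}"
    using bij_betw_trans[OF inj_on_imp_bij_betw[OF inj] bij_betw_inv_into[OF bij]] .
  then have "bij_betw \<pi> {..<r} {..<r}"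
    by (rule iffD1[OF bij_betw_cong, rotated]) (simp add: \<pi>_def)
  then have "\<pi> permutes {..<r}" by (rule bij_imp_permutes) (simp add: \<pi>_def)
  moreover have "f i = pick ?I (\<pi> i)" if "i < r" for i
    using bij_betw_inv_into_right[OF bij, of "f i"] that by (simp add: \<pi>_def)
  ultimately show thesis by (rule that)
qed

lemma subdet_minors:
  assumes f: "f \<in> {..<r} \<rightarrow> {..<dim_row Y}" and g: "g \<in> {..<r} \<rightarrow> {..<dim_col Y}"
  defines "m \<equiv> subdet (\<lambda>i j. Y $$ (i, j)) r f g"
  shows "m = 0 \<or> m \<in> minors r Y \<or> - m \<in> minors r Y"
proof (cases "inj_on f {..<r} \<and> inj_on g {..<r}")
  case True
  let ?I = "f ` {..<r}" and ?J = "g ` {..<r}"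
  obtain \<pi> \<rho> where \<pi>: "\<pi> permutes {..<r}" "\<And>i. i < r \<Longrightarrow> f i = pick ?I (\<pi> i)"
    and \<rho>: "\<rho> permutes {..<r}" "\<And>i. i < r \<Longrightarrow> g i = pick ?J (\<rho> i)"
    using sorting_permutation True by metis
  let ?s = "subdet (\<lambda>i j. Y $$ (i, j)) r (pick ?I) (pick ?J)"
  have "m = subdet (\<lambda>i j. Y $$ (i, j)) r (pick ?I \<circ> \<pi>) (pick ?J \<circ> \<rho>)"
    unfolding m_def by (rule subdet_cong) (simp flip: \<pi>(2) \<rho>(2))
  also have "\<dots> = signof \<pi> * (signof \<rho> * ?s)"
    by (simp add: subdet_permute_rows[OF \<pi>(1)] subdet_permute_columns[OF \<rho>(1)])
  finally have "m = ?s \<or> - m = ?s" by (auto simp: sign_def split: if_splits)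
  moreover have "?s \<in> minors r Y"
  proof -
    have sub: "?I \<subseteq> {..<dim_row Y}" "?J \<subseteq> {..<dim_col Y}" using f g by auto
    have c: "card ?I = r" "card ?J = r" using True by (auto simp: card_image)
    have "{i. i < dim_row Y \<and> i \<in> ?I} = ?I" "{j. j < dim_col Y \<and> j \<in> ?J} = ?J" using sub by auto
    then have "?s = det (submatrix Y ?I ?J)"
      unfolding subdet_def submatrix_def using c by simp
    then show ?thesis unfolding minors_def using sub c by blast
  qed
  ultimately show ?thesis by auto
next
  case False
  then have "m = 0"
    unfolding m_def inj_on_def using subdet_equal_rows[of _ r _ f] subdet_equal_columns[of _ r _ _ f g]
    by (metis lessThan_iff)
  then show ?thesis ..
qed

abbreviation generic :: "nat \<Rightarrow> col \<Rightarrow> cpoly" where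
  "generic \<equiv> \<lambda>i c. indet (i, c)"

definition minors_in :: "nat \<Rightarrow> cpoly set \<Rightarrow> nat \<Rightarrow> col set \<Rightarrow> bool" where
  "minors_in d J r U \<longleftrightarrow>
     (\<forall>f\<in>{..<r} \<rightarrow> {1..d}. \<forall>g\<in>{..<r} \<rightarrow> U. subdet generic r f g \<in> J)"

lemma minors_Xsub_subset_iff:
  assumes J: "ideal J (CX d k2)" and U: "U \<subseteq> columns k2"
  shows "minors r (Xsub d k2 U) \<subseteq> J \<longleftrightarrow> minors_in d J r U"
proof -
  let ?X = "Xsub d k2 U"
  define cs where "cs = filter (\<lambda>c. c \<in> U) (List.product [1..<3] [1..<Suc k2])"
  have set_cs: "set cs = U" using U by (auto simp: cs_def columns_def)
  have dim: "dim_row ?X = d" "dim_col ?X = length cs" by (simp_all add: Xsub_def cs_def Let_def)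
  have X: "?X $$ (i, j) = generic (Suc i) (cs ! j)" if "i < d" "j < length cs" for i j
    using that unfolding Xsub_def Let_def cs_def[symmetric] by simp
  note JD = ideal_poly_ringD[OF J[unfolded CX_def]]
  show ?thesis
  proof
    assume sub: "minors r ?X \<subseteq> J"
    show "minors_in d J r U"
      unfolding minors_in_def
    proof (intro ballI)
      fix f g assume f: "f \<in> {..<r} \<rightarrow> {1..d}" and g: "g \<in> {..<r} \<rightarrow> U"
      have "\<exists>j<length cs. cs ! j = g k" if "k < r" for k
        using g that set_cs by (auto simp: in_set_conv_nth)
      then obtain h where h: "\<And>k. k < r \<Longrightarrow> h k < length cs \<and> cs ! h k = g k" by metis
      have f': "f i - 1 < d" "Suc (f i - 1) = f i" if "i < r" for i
      proof -
        have "f i \<in> {1..d}" using f that by blast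
        then show "f i - 1 < d" "Suc (f i - 1) = f i" by auto
      qed
      define m where "m = subdet (\<lambda>i j. ?X $$ (i, j)) r (\<lambda>i. f i - 1) h"
      have "m = 0 \<or> m \<in> minors r ?X \<or> - m \<in> minors r ?X"
        unfolding m_def by (rule subdet_minors) (use f' h dim in auto)
      then have "m \<in> J" using sub JD(2) JD(5)[of "- m"] by auto
      moreover have "m = subdet generic r f g"
        unfolding m_def by (rule subdet_cong) (use f' h X in auto)
      ultimately show "subdet generic r f g \<in> J" by simp
    qed
  next
    assume all: "minors_in d J r U"
    show "minors r ?X \<subseteq> J"
    proof
      fix m assume "m \<in> minors r ?X"
      then obtain f g where f: "f \<in> {..<r} \<rightarrow> {..<d}" and g: "g \<in> {..<r} \<rightarrow> {..<length cs}"
        and m: "m = subdet (\<lambda>i j. ?X $$ (i, j)) r f g"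
        by (rule minors_subdet[of m r ?X, unfolded dim])
      have "m = subdet generic r (Suc \<circ> f) (\<lambda>k. cs ! g k)"
        unfolding m by (rule subdet_cong) (use f g X in auto)
      moreover have "Suc \<circ> f \<in> {..<r} \<rightarrow> {1..d}"
        using f by (auto simp: Pi_iff Suc_le_eq)
      moreover have "(\<lambda>k. cs ! g k) \<in> {..<r} \<rightarrow> U"
        using g nth_mem[of _ cs] set_cs by (auto simp: Pi_iff)
      ultimately show "m \<in> J" using all by (simp add: minors_in_def)
    qed
  qed
qed


section \<open>Membership of minors in an ideal\<close>

lemma minors_in_mono: "minors_in d J r U \<Longrightarrow> V \<subseteq> U \<Longrightarrow> minors_in d J r V"
  by (fastforce simp: minors_in_def)

lemma subdet_1: "subdet a 1 f g = a (f 0) (g 0)"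
  using subdet_expand_column[of 0 0 a f g] by (simp add: subdet_0)

lemma minors_in_1_iff: "minors_in d J 1 U \<longleftrightarrow> (\<forall>i\<in>{1..d}. \<forall>c\<in>U. generic i c \<in> J)"
proof
  assume L: "minors_in d J 1 U"
  show "\<forall>i\<in>{1..d}. \<forall>c\<in>U. generic i c \<in> J"
  proof (intro ballI)
    fix i c assume "i \<in> {1..d}" "c \<in> U"
    then have "subdet generic 1 (\<lambda>_. i) (\<lambda>_. c) \<in> J"
      using L unfolding minors_in_def by blast
    then show "generic i c \<in> J" by (simp only: subdet_1)
  qed
next
  assume "\<forall>i\<in>{1..d}. \<forall>c\<in>U. generic i c \<in> J"
  then show "minors_in d J 1 U" unfolding minors_in_def subdet_1 by blast
qed

lemma subdet_generic_closed:
  assumes "f \<in> {..<r} \<rightarrow> {1..d}" "g \<in> {..<r} \<rightarrow> columns k2"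
  shows "subdet generic r f g \<in> carrier (CX d k2)"
  unfolding subdet_def CX_def
  by (rule det_closed_poly_ring) (use assms in \<open>auto simp: Pi_iff intro: indet_closed_poly_ring\<close>)

lemma insert_index_Pi:
  "f \<in> {..<Suc r} \<rightarrow> A \<Longrightarrow> f \<circ> insert_index p \<in> {..<r} \<rightarrow> A"
  by (auto simp: Pi_iff insert_index_def)

text \<open>The two alternatives serve columns whose entries lie in the ideal and columns whose complementary
  minors do.\<close>

lemma subdet_in_ideal_by_expansion:
  assumes J: "ideal J (CX d k2)" and p: "p < Suc r"
    and f: "f \<in> {..<Suc r} \<rightarrow> {1..d}" and g: "g \<in> {..<Suc r} \<rightarrow> columns k2"
    and mem: "\<And>i. i < Suc r \<Longrightarrow> generic (f i) (g p) \<in> J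
      \<or> subdet generic r (f \<circ> insert_index i) (g \<circ> insert_index p) \<in> J"
  shows "subdet generic (Suc r) f g \<in> J"
proof -
  note JP = J[unfolded CX_def]
  note JD = ideal_poly_ringD[OF JP]
  show ?thesis
    unfolding subdet_expand_column[OF p]
  proof (rule ideal_poly_ring_sum[OF JP])
    fix i assume i: "i \<in> {..<Suc r}"
    let ?a = "generic (f i) (g p)"
    let ?s = "subdet generic r (f \<circ> insert_index i) (g \<circ> insert_index p)"
    have a: "?a \<in> carrier (CX d k2)"
      unfolding CX_def by (rule indet_closed_poly_ring) (use f g i p in blast)
    have s: "?s \<in> carrier (CX d k2)"
      by (rule subdet_generic_closed[OF insert_index_Pi[OF f] insert_index_Pi[OF g]])
    have "?a * ?s \<in> J"
    proof (cases "?a \<in> J")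
      case True
      then show ?thesis using JD(4)[of ?s ?a] s by (simp add: CX_def mult.commute)
    next
      case False
      then show ?thesis using mem[of i] i JD(4)[of ?a ?s] a by (simp add: CX_def)
    qed
    then show "?a * ((- 1) ^ (i + p) * ?s) \<in> J"
      using JD(5) by (cases "even (i + p)") simp_all
  qed
qed

lemma minors_in_zero_columns:
  assumes J: "ideal J (CX d k2)" and U: "U \<union> Z \<subseteq> columns k2"
    and "minors_in d J r U" and Z: "minors_in d J 1 Z"
  shows "minors_in d J r (U \<union> Z)"
  unfolding minors_in_def
proof (intro ballI)
  fix f g assume f: "f \<in> {..<r} \<rightarrow> {1..d}" and g: "g \<in> {..<r} \<rightarrow> U \<union> Z"
  show "subdet generic r f g \<in> J"
  proof (cases "g \<in> {..<r} \<rightarrow> U")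
    case True
    then show ?thesis using assms(3) f by (simp add: minors_in_def)
  next
    case False
    then obtain p where p: "p < r" "g p \<in> Z" using g by (auto simp: Pi_iff)
    then obtain s where s: "r = Suc s" by (cases r) auto
    show ?thesis
      unfolding s
    proof (rule subdet_in_ideal_by_expansion[OF J])
      show "p < Suc s" "f \<in> {..<Suc s} \<rightarrow> {1..d}" "g \<in> {..<Suc s} \<rightarrow> columns k2"
        using p f g U s by auto
      fix i assume "i < Suc s"
      then have "f i \<in> {1..d}" using f s by blast
      then have "generic (f i) (g p) \<in> J" using Z p(2) unfolding minors_in_1_iff by blast
      then show "generic (f i) (g p) \<in> J
        \<or> subdet generic s (f \<circ> insert_index i) (g \<circ> insert_index p) \<in> J" ..
    qed
  qed
qed

text \<open>Laplace expansion along the two columns of a block, obtained by expanding along the other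
  columns one at a time until a 2-minor of the block is left.\<close>

lemma subdet_repeated_block:
  assumes J: "ideal J (CX d k2)"
    and blocks: "\<And>l. l \<in> {1..k2} \<Longrightarrow> minors_in d J 2 (Cblock l)"
    and "p < r" "q < r" "p \<noteq> q" "snd (g p) = snd (g q)"
    and "f \<in> {..<r} \<rightarrow> {1..d}" "g \<in> {..<r} \<rightarrow> columns k2"
  shows "subdet generic r f g \<in> J"
  using assms(3-)
proof (induction r arbitrary: f g p q)
  case (Suc r)
  show ?case
  proof (cases "r = 1")
    case True
    let ?l = "snd (g p)"
    have Suc_r: "Suc r = 2" using True by simp
    have mem: "g k \<in> columns k2" if "k < 2" for k
      using Suc.prems(6) that unfolding Suc_r by blast
    have "g \<in> {..<2} \<rightarrow> Cblock ?l"
    proof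
      fix k assume k: "k \<in> {..<2::nat}"
      then have "k = p \<or> k = q" using Suc.prems(1-3) True by auto
      then have "snd (g k) = ?l" using Suc.prems(4) by auto
      then show "g k \<in> Cblock ?l" using mem[of k] k by (cases "g k") (auto simp: columns_def Cblock_def)
    qed
    moreover have "?l \<in> {1..k2}"
      using mem[of p] Suc.prems(1) Suc_r by (cases "g p") (auto simp: columns_def)
    ultimately show ?thesis
      using blocks[of ?l] Suc.prems(5) unfolding minors_in_def Suc_r by blast
  next
    case False
    have "card ({..<Suc r} - {p, q}) = r - 1" using Suc.prems by (simp add: card_Diff_subset)
    moreover have "r \<noteq> 0" using Suc.prems by auto
    ultimately have "card ({..<Suc r} - {p, q}) \<noteq> 0" using False by simp
    then have "{..<Suc r} - {p, q} \<noteq> {}" by (metis card.empty)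
    then obtain m where m: "m < Suc r" "m \<noteq> p" "m \<noteq> q" by auto
    have "p \<in> insert_index m ` {0..<r}" "q \<in> insert_index m ` {0..<r}"
      using insert_index_image[of m r] m Suc.prems by auto
    then obtain p' q' where pq: "p' < r" "p = insert_index m p'" "q' < r" "q = insert_index m q'"
      by auto
    show ?thesis
    proof (rule subdet_in_ideal_by_expansion[OF J m(1) Suc.prems(5,6)])
      fix i assume "i < Suc r"
      have "subdet generic r (f \<circ> insert_index i) (g \<circ> insert_index m) \<in> J"
      proof (rule Suc.IH[of p' q'])
        show "p' < r" "q' < r" "p' \<noteq> q'" using pq Suc.prems(3) by auto
        show "snd ((g \<circ> insert_index m) p') = snd ((g \<circ> insert_index m) q')"
          using Suc.prems(4) pq by simp
      qed (intro insert_index_Pi Suc.prems)+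
      then show "generic (f i) (g m) \<in> J
        \<or> subdet generic r (f \<circ> insert_index i) (g \<circ> insert_index m) \<in> J" ..
    qed
  qed
qed simp

lemma minors_in_few_blocks:
  assumes J: "ideal J (CX d k2)"
    and blocks: "\<And>l. l \<in> {1..k2} \<Longrightarrow> minors_in d J 2 (Cblock l)"
    and U: "U \<subseteq> columns k2" and L: "finite L" "snd ` U \<subseteq> L" "card L < r"
  shows "minors_in d J r U"
  unfolding minors_in_def
proof (intro ballI)
  fix f g assume f: "f \<in> {..<r} \<rightarrow> {1..d}" and g: "g \<in> {..<r} \<rightarrow> U"
  have "(snd \<circ> g) ` {..<r} \<subseteq> L" using g L(2) by auto
  then have "card ((snd \<circ> g) ` {..<r}) < card {..<r}"
    using card_mono[OF L(1)] L(3) by (metis card_lessThan le_less_trans)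
  then have "\<not> inj_on (snd \<circ> g) {..<r}" by (rule pigeonhole)
  then obtain p q where "p < r" "q < r" "p \<noteq> q" "snd (g p) = snd (g q)"
    by (auto simp: inj_on_def)
  moreover have "g \<in> {..<r} \<rightarrow> columns k2" using g U by auto
  ultimately show "subdet generic r f g \<in> J" using subdet_repeated_block[OF J blocks] f by blast
qed


section \<open>The ideals \<open>I\<^sub>S\<close> and \<open>I\<^sub>C\<close>\<close>

lemma Cblock_subset: "j \<in> {1..k2} \<Longrightarrow> Cblock j \<subseteq> columns k2"
  by (auto simp: Cblock_def columns_def)

lemma Rblock_subset: "p \<in> {1, 2} \<Longrightarrow> Rblock k2 p \<subseteq> columns k2"
  by (auto simp: Rblock_def columns_def)

lemma Cfree_iff: "(r, l) \<in> Cfree k2 S \<longleftrightarrow> r \<in> {1, 2} \<and> l \<in> {1..k2} \<and> (1, l) \<notin> S \<and> (2, l) \<notin> S"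
proof -
  have "{1..2::nat} = {1, 2}" by auto
  then show ?thesis by (auto simp: Cfree_def Cblock_def)
qed

lemma Cblock_iff: "(r, l) \<in> Cblock j \<longleftrightarrow> r \<in> {1, 2} \<and> l = j"
  by (auto simp: Cblock_def)

lemma Rblock_iff: "(r, l) \<in> Rblock k2 p \<longleftrightarrow> r = p \<and> l \<in> {1..k2}"
  by (auto simp: Rblock_def)

lemma columns_iff: "(r, l) \<in> columns k2 \<longleftrightarrow> r \<in> {1, 2} \<and> l \<in> {1..k2}"
  by (auto simp: columns_def)

lemma Cblock_disjoint_iff: "Cblock j \<inter> S = {} \<longleftrightarrow> (1, j) \<notin> S \<and> (2, j) \<notin> S"
proof -
  have "{1..2::nat} = {1, 2}" by auto
  then show ?thesis by (auto simp: Cblock_def)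
qed

lemma Cblock_subset_iff: "Cblock j \<subseteq> S \<longleftrightarrow> (1, j) \<in> S \<and> (2, j) \<in> S"
proof -
  have "{1..2::nat} = {1, 2}" by auto
  then show ?thesis by (auto simp: Cblock_def)
qed

text \<open>The column sets whose minors of size \<open>t\<close> are among the generators of \<open>I\<^sub>S\<close>, and the condition
  under which the minors of size \<open>t - 1\<close> are; both for the two rows \<open>p\<close> and \<open>3 - p\<close> of the block
  grid at once, which gives access to their symmetry.\<close>

definition free_part :: "nat \<Rightarrow> col set \<Rightarrow> nat \<Rightarrow> col set" where
  "free_part k2 S p = (Rblock k2 p - S) \<union> Cfree k2 S"

definition mixed :: "nat \<Rightarrow> col set \<Rightarrow> bool" where
  "mixed k2 S \<longleftrightarrow> (\<forall>p\<in>{1, 2}. \<exists>j\<in>{1..k2}. (p, j) \<in> S \<and> (3 - p, j) \<notin> S)"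

lemma not_mixed_empty: "\<not> mixed k2 {}"
  unfolding mixed_def by blast

lemma free_part_iff:
  "(r, l) \<in> free_part k2 S p \<longleftrightarrow> l \<in> {1..k2} \<and>
     (r = p \<and> (p, l) \<notin> S \<or> r \<in> {1, 2} \<and> (1, l) \<notin> S \<and> (2, l) \<notin> S)"
  by (auto simp: free_part_def Cfree_iff Rblock_iff)

lemma Cfree_subset: "Cfree k2 S \<subseteq> columns k2"
  by (auto simp: Cfree_iff columns_iff)

lemma free_part_subset: "p \<in> {1, 2} \<Longrightarrow> free_part k2 S p \<subseteq> columns k2"
  by (auto simp: free_part_iff columns_iff)

lemma ideal_generated: "A \<subseteq> carrier (CX d k2) \<Longrightarrow> ideal (Idl\<^bsub>CX d k2\<^esub> A) (CX d k2)"
  using ring.genideal_ideal[OF ring_poly_ring] by (simp add: CX_def)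

lemma generated_subset_iff:
  assumes "A \<subseteq> carrier (CX d k2)" "ideal J (CX d k2)"
  shows "Idl\<^bsub>CX d k2\<^esub> A \<subseteq> J \<longleftrightarrow> A \<subseteq> J"
proof -
  have R: "ring (CX d k2)" by (simp add: CX_def ring_poly_ring)
  show ?thesis
    using ring.genideal_self[OF R assms(1)] ring.genideal_minimal[OF R assms(2)] by blast
qed

text \<open>For \<open>S = {}\<close> both free parts consist of all columns, no column is required to be zero and \<open>S\<close> is
  not mixed, so that the separate clause for the empty set in the definition of the generators is an
  instance of the general one.\<close>

lemma I_S_subset_iff:
  assumes S: "S \<subseteq> columns k2" and J: "ideal J (CX d k2)"
  shows "I_S d k2 t S \<subseteq> J \<longleftrightarrow> minors_in d J 1 S
    \<and> (\<forall>j\<in>{1..k2}. Cblock j \<inter> S = {} \<longrightarrow> minors_in d J 2 (Cblock j))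
    \<and> (mixed k2 S \<longrightarrow> minors_in d J (t - 1) (Cfree k2 S))
    \<and> (\<forall>p\<in>{1, 2}. minors_in d J t (free_part k2 S p))"
proof -
  note iff = minors_Xsub_subset_iff[OF J]
  have mix: "G_S d k2 t S = (if mixed k2 S then minors (t - 1) (Xsub d k2 (Cfree k2 S)) else {})"
    by (simp add: G_S_def mixed_def)
  have F: "I_S d k2 t S \<subseteq> J \<longleftrightarrow> F_S d k2 t S \<subseteq> J"
    unfolding I_S_def by (rule generated_subset_iff[OF F_S_closed J])
  show ?thesis
  proof (cases "S = {}")
    case True
    have "Cfree k2 {} = columns k2" by (auto simp: Cfree_iff columns_iff)
    then have "free_part k2 {} p = columns k2" if "p \<in> {1, 2}" for p
      using Rblock_subset[OF that, of k2] by (auto simp: free_part_def)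
    then have "(\<forall>p\<in>{1, 2}. minors_in d J t (free_part k2 {} p)) \<longleftrightarrow> minors_in d J t (columns k2)"
      by auto
    moreover have "minors_in d J 1 {}" by (simp only: minors_in_1_iff, simp)
    moreover have "\<not> mixed k2 {}" by (rule not_mixed_empty)
    ultimately show ?thesis
      unfolding F using True
      by (simp add: F_S_def iff Cblock_subset UN_subset_iff)
  next
    case False
    then have "F_S d k2 t S = minors 1 (Xsub d k2 S) \<union>
        (\<Union>j\<in>{j\<in>{1..k2}. Cblock j \<inter> S = {}}. minors 2 (Xsub d k2 (Cblock j))) \<union>
        (if mixed k2 S then minors (t - 1) (Xsub d k2 (Cfree k2 S)) else {}) \<union>
        minors t (Xsub d k2 (free_part k2 S 1)) \<union> minors t (Xsub d k2 (free_part k2 S 2))"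
      by (simp only: F_S_def mix free_part_def if_False)
    moreover have "minors t (Xsub d k2 (free_part k2 S p)) \<subseteq> J
        \<longleftrightarrow> minors_in d J t (free_part k2 S p)" if "p \<in> {1, 2}" for p
      by (rule iff[OF free_part_subset[OF that]])
    moreover have "(\<Union>j\<in>{j\<in>{1..k2}. Cblock j \<inter> S = {}}. minors 2 (Xsub d k2 (Cblock j))) \<subseteq> J
        \<longleftrightarrow> (\<forall>j\<in>{1..k2}. Cblock j \<inter> S = {} \<longrightarrow> minors_in d J 2 (Cblock j))"
      using iff[OF Cblock_subset] by (auto simp: UN_subset_iff)
    ultimately show ?thesis
      unfolding F by (simp add: iff[OF S] iff[OF Cfree_subset])
  qed
qed

lemma ideal_I_S: "ideal (I_S d k2 t S) (CX d k2)"
  unfolding I_S_def by (rule ideal_generated[OF F_S_closed])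

lemmas I_S_contains = I_S_subset_iff[OF _ ideal_I_S, THEN iffD1, OF _ subset_refl]

lemma generic_in_I_S: "S \<subseteq> columns k2 \<Longrightarrow> c \<in> S \<Longrightarrow> i \<in> {1..d} \<Longrightarrow> generic i c \<in> I_S d k2 t S"
  using I_S_contains[of S k2 d t] unfolding minors_in_1_iff by blast

text \<open>If \<open>Cblock j\<close> meets \<open>S\<close>, each of its 2-minors has a column that is zero modulo \<open>I\<^sub>S\<close>.\<close>

lemma I_S_contains_blocks:
  assumes S: "S \<subseteq> columns k2" and j: "j \<in> {1..k2}"
  shows "minors_in d (I_S d k2 t S) 2 (Cblock j)"
proof (cases "Cblock j \<inter> S = {}")
  case True
  then show ?thesis using I_S_contains[OF S, of d t] j by blast
next
  case False
  let ?J = "I_S d k2 t S"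
  have "minors_in d ?J 2 (Cblock j - S)"
    unfolding minors_in_def
  proof (intro ballI)
    fix f g assume g: "g \<in> {..<2::nat} \<rightarrow> Cblock j - S"
    obtain c where "Cblock j - S \<subseteq> {c}"
      using False unfolding Cblock_disjoint_iff by (auto simp: subset_iff Cblock_iff)
    moreover have "g 0 \<in> Cblock j - S" "g 1 \<in> Cblock j - S" using g by (simp_all add: Pi_iff)
    ultimately have "g 0 = g 1" by blast
    then have "subdet generic 2 f g = 0" by (intro subdet_equal_columns[of 0 _ 1]) auto
    then show "subdet generic 2 f g \<in> ?J"
      using ideal_poly_ringD(2)[OF ideal_I_S[unfolded CX_def]] by metis
  qed
  then have "minors_in d ?J 2 ((Cblock j - S) \<union> S)"
    using I_S_contains[OF S, of d t] S Cblock_subset[OF j]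
    by (intro minors_in_zero_columns[OF ideal_I_S]) auto
  then show ?thesis by (rule minors_in_mono) auto
qed

text \<open>The 2-minors of the blocks never obstruct an inclusion, so they drop out of the criterion.\<close>

lemma I_S_subset_I_SI:
  assumes "S \<subseteq> columns k2" "S' \<subseteq> columns k2"
    and "minors_in d (I_S d k2 t S) 1 S'"
    and "mixed k2 S' \<Longrightarrow> minors_in d (I_S d k2 t S) (t - 1) (Cfree k2 S')"
    and "\<And>p. p \<in> {1, 2} \<Longrightarrow> minors_in d (I_S d k2 t S) t (free_part k2 S' p)"
  shows "I_S d k2 t S' \<subseteq> I_S d k2 t S"
  unfolding I_S_subset_iff[OF assms(2) ideal_I_S] using assms I_S_contains_blocks[OF assms(1)] by blast

lemma minors_in_I_S_up_to_S:
  assumes "S \<subseteq> columns k2" "p \<in> {1, 2}" "U \<subseteq> free_part k2 S p \<union> S"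
  shows "minors_in d (I_S d k2 t S) t U"
proof -
  have "minors_in d (I_S d k2 t S) t (free_part k2 S p \<union> S)"
    using I_S_contains[OF assms(1), of d t] assms(1,2) free_part_subset[OF assms(2), of k2 S]
    by (intro minors_in_zero_columns[OF ideal_I_S]) auto
  then show ?thesis by (rule minors_in_mono) fact
qed

lemma I_C_subset_iff:
  assumes J: "ideal J (CX d k2)"
  shows "I_C d k2 t \<subseteq> J \<longleftrightarrow> (\<forall>j\<in>{1..k2}. minors_in d J 2 (Cblock j))
    \<and> (\<forall>p\<in>{1, 2}. minors_in d J t (Rblock k2 p))"
proof -
  have "{1..2::nat} = {1, 2}" by auto
  moreover have "(\<Union>j\<in>{1..k2}. minors 2 (Xsub d k2 (Cblock j))) \<union>
      (\<Union>i\<in>{1..2}. minors t (Xsub d k2 (Rblock k2 i))) \<subseteq> carrier (CX d k2)"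
    using minors_closed by blast
  ultimately show ?thesis
    unfolding I_C_def by (subst generated_subset_iff[OF _ J])
      (auto simp: UN_subset_iff minors_Xsub_subset_iff[OF J] Cblock_subset Rblock_subset)
qed

lemma ideal_I_C: "ideal (I_C d k2 t) (CX d k2)"
  unfolding I_C_def by (rule ideal_generated) (use minors_closed in blast)

lemma I_C_subset_I_S:
  assumes S: "S \<subseteq> columns k2"
  shows "I_C d k2 t \<subseteq> I_S d k2 t S"
  unfolding I_C_subset_iff[OF ideal_I_S]
proof (intro conjI ballI)
  show "minors_in d (I_S d k2 t S) t (Rblock k2 p)" if "p \<in> {1, 2}" for p
    by (rule minors_in_I_S_up_to_S[OF S that]) (auto simp: free_part_def)
qed (rule I_S_contains_blocks[OF S])


section \<open>Points\<close>

definition vanishing_ideal :: "nat \<Rightarrow> nat \<Rightarrow> (nat \<times> col \<Rightarrow> complex) \<Rightarrow> cpoly set" where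
  "vanishing_ideal d k2 x = {f \<in> carrier (CX d k2). eval_mpoly x f = 0}"

lemma ideal_vanishing_ideal: "ideal (vanishing_ideal d k2 x) (CX d k2)"
  unfolding vanishing_ideal_def CX_def by (rule ideal_vanishing_at)

lemma minors_in_vanishing_ideal_iff:
  assumes "U \<subseteq> columns k2"
  shows "minors_in d (vanishing_ideal d k2 x) r U
    \<longleftrightarrow> minors_vanish (\<lambda>i c. x (i, c)) {1..d} U r"
proof -
  have "subdet generic r f g \<in> vanishing_ideal d k2 x
      \<longleftrightarrow> subdet (\<lambda>i c. x (i, c)) r f g = 0"
    if "f \<in> {..<r} \<rightarrow> {1..d}" "g \<in> {..<r} \<rightarrow> U" for f g
  proof -
    have "g \<in> {..<r} \<rightarrow> columns k2" using that(2) assms by auto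
    then show ?thesis
      using subdet_generic_closed[OF that(1)]
      by (simp add: vanishing_ideal_def eval.hom_subdet eval_mpoly_indet)
  qed
  then show ?thesis unfolding minors_in_def minors_vanish_def by blast
qed

text \<open>Column \<open>c\<close> of this matrix is the unit vector with index \<open>e c\<close>; since rows are numbered from 1,
  the value \<open>e c = 0\<close> stands for the zero column.\<close>

definition unit_columns :: "(col \<Rightarrow> nat) \<Rightarrow> nat \<times> col \<Rightarrow> complex" where
  "unit_columns e = (\<lambda>(i, c). if i = e c then 1 else 0)"

text \<open>Among \<open>r\<close> columns taken from zero and fewer than \<open>r\<close> unit vectors, one is zero or two agree.\<close>

lemma minors_in_unit_columns:
  assumes U: "U \<subseteq> columns k2" and E: "finite E" "card E < r" "e ` U \<subseteq> insert 0 E"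
  shows "minors_in d (vanishing_ideal d k2 (unit_columns e)) r U"
  unfolding minors_in_vanishing_ideal_iff[OF U] minors_vanish_def
proof (intro ballI)
  fix f g assume f: "f \<in> {..<r} \<rightarrow> {1..d}" and g: "g \<in> {..<r} \<rightarrow> U"
  let ?a = "\<lambda>i c. unit_columns e (i, c)"
  show "subdet ?a r f g = 0"
  proof (cases "\<exists>p<r. e (g p) = 0")
    case True
    then obtain p where p: "p < r" "e (g p) = 0" by blast
    have "?a (f i) (g p) = 0" if "i < r" for i
    proof -
      have "f i \<in> {1..d}" using f that by blast
      then show ?thesis using p by (simp add: unit_columns_def)
    qed
    then show ?thesis by (rule subdet_zero_column[OF p(1)])
  next
    case False
    then have "(e \<circ> g) ` {..<r} \<subseteq> E" using g E(3) by fastforce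
    then have "card ((e \<circ> g) ` {..<r}) < card {..<r}"
      using card_mono[OF E(1)] E(2) by (metis card_lessThan le_less_trans)
    then have "\<not> inj_on (e \<circ> g) {..<r}" by (rule pigeonhole)
    then obtain p q where "p < r" "q < r" "p \<noteq> q" "e (g p) = e (g q)"
      by (auto simp: inj_on_def)
    then show ?thesis by (intro subdet_equal_columns[of p r q]) (auto simp: unit_columns_def)
  qed
qed

lemma not_minors_in_unit_columns:
  assumes "r \<le> d" "U \<subseteq> columns k2" "g \<in> {..<r} \<rightarrow> U" "\<And>k. k < r \<Longrightarrow> e (g k) = Suc k"
  shows "\<not> minors_in d (vanishing_ideal d k2 (unit_columns e)) r U"
proof -
  have "subdet (\<lambda>i c. unit_columns e (i, c)) r Suc g = det (1\<^sub>m r)"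
    unfolding subdet_def
    by (rule arg_cong[of _ _ det], rule eq_matI) (use assms(4) in \<open>auto simp: unit_columns_def\<close>)
  moreover have "Suc \<in> {..<r} \<rightarrow> {1..d}" using assms(1) by auto
  ultimately show ?thesis
    unfolding minors_in_vanishing_ideal_iff[OF assms(2)] minors_vanish_def using assms(3) by fastforce
qed

text \<open>The witness is the matrix whose nonzero columns all equal the first unit vector and form the
  block of \<open>c\<close>, minus \<open>S\<close>. It has rank 1, so only the condition that certain minors of size
  \<open>t - 1 = 1\<close> vanish could exclude it.\<close>

lemma generic_not_in_I_S:
  assumes S: "S \<subseteq> columns k2" and t: "2 \<le> t" and c: "c \<in> columns k2" "c \<notin> S"
    and special: "\<not> (mixed k2 S \<and> t = 2 \<and> c \<in> Cfree k2 S)"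
  shows "generic 1 c \<notin> I_S d k2 t S"
proof
  assume mem: "generic 1 c \<in> I_S d k2 t S"
  obtain p l where pl: "c = (p, l)" by (cases c)
  define e where "e = (\<lambda>c'. if snd c' = l \<and> c' \<notin> S then 1 else 0 :: nat)"
  let ?J = "vanishing_ideal d k2 (unit_columns e)"
  have E: "e ` U \<subseteq> insert 0 {1}" for U by (auto simp: e_def)
  have "I_S d k2 t S \<subseteq> ?J"
    unfolding I_S_subset_iff[OF S ideal_vanishing_ideal]
  proof (intro conjI ballI impI)
    show "minors_in d ?J 1 S"
      by (rule minors_in_unit_columns[OF S, of "{}"]) (auto simp: e_def)
    show "minors_in d ?J 2 (Cblock j)" if "j \<in> {1..k2}" for j
      by (rule minors_in_unit_columns[OF Cblock_subset[OF that] _ _ E]) auto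
    show "minors_in d ?J t (free_part k2 S p)" if "p \<in> {1, 2}" for p
      by (rule minors_in_unit_columns[OF free_part_subset[OF that] _ _ E]) (use t in auto)
    assume mix: "mixed k2 S"
    show "minors_in d ?J (t - 1) (Cfree k2 S)"
    proof (cases "t = 2")
      case True
      then have "c \<notin> Cfree k2 S" using special mix by blast
      then have "e ` Cfree k2 S \<subseteq> insert 0 {}"
        using c by (auto simp: e_def pl Cfree_iff columns_iff)
      then show ?thesis
        by (rule minors_in_unit_columns[OF Cfree_subset, rotated 2]) (use t in auto)
    next
      case False
      then show ?thesis
        by (intro minors_in_unit_columns[OF Cfree_subset _ _ E]) (use t in auto)
    qed
  qed
  then have "eval_mpoly (unit_columns e) (generic 1 c) = 0"
    using mem by (auto simp: vanishing_ideal_def)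
  then show False using c by (simp add: eval_mpoly_indet unit_columns_def e_def pl)
qed


section \<open>Minimal subsets give minimal ideals\<close>

lemma card_Rblock_Int: "card (Rblock k2 p \<inter> S) = card {l\<in>{1..k2}. (p, l) \<in> S}"
proof -
  have "Rblock k2 p \<inter> S = Pair p ` {l\<in>{1..k2}. (p, l) \<in> S}" by (auto simp: Rblock_def)
  then show ?thesis by (simp add: card_image inj_on_def)
qed

lemma card_not_in_row: "card {l\<in>{1..k2}. (p, l) \<notin> S} = k2 - card (Rblock k2 p \<inter> S)"
proof -
  have "{l\<in>{1..k2}. (p, l) \<notin> S} = {1..k2} - {l\<in>{1..k2}. (p, l) \<in> S}" by auto
  moreover have "card ({1..k2} - {l\<in>{1..k2}. (p, l) \<in> S}) = k2 - card {l\<in>{1..k2}. (p, l) \<in> S}"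
    by (subst card_Diff_subset) auto
  ultimately show ?thesis by (simp only: card_Rblock_Int)
qed

lemma card_rows_and_free_blocks:
  assumes "\<And>j. j \<in> {1..k2} \<Longrightarrow> \<not> Cblock j \<subseteq> S"
  shows "card (Rblock k2 1 \<inter> S) + card (Rblock k2 2 \<inter> S)
    + card {l\<in>{1..k2}. (1, l) \<notin> S \<and> (2, l) \<notin> S} = k2"
proof -
  let ?A = "{l\<in>{1..k2}. (1, l) \<in> S}" and ?B = "{l\<in>{1..k2}. (2, l) \<in> S}"
    and ?M = "{l\<in>{1..k2}. (1, l) \<notin> S \<and> (2, l) \<notin> S}"
  have "?A \<inter> ?B = {}" using assms by (auto simp: Cblock_subset_iff)
  then have "card (?A \<union> ?B) = card ?A + card ?B" by (intro card_Un_disjoint) auto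
  moreover have "card ((?A \<union> ?B) \<union> ?M) = card (?A \<union> ?B) + card ?M"
    by (intro card_Un_disjoint) auto
  moreover have "(?A \<union> ?B) \<union> ?M = {1..k2}" by auto
  ultimately show ?thesis by (simp add: card_Rblock_Int)
qed

lemma minimal_subset_iff:
  "minimal_subset k2 t S \<longleftrightarrow> S = {} \<or>
    (\<forall>j\<in>{1..k2}. \<not> Cblock j \<subseteq> S) \<and>
    (\<forall>p\<in>{1, 2}. 1 \<le> card (Rblock k2 p \<inter> S) \<and> card (Rblock k2 p \<inter> S) \<le> k2 - t + 1) \<and>
    (t = 2 \<longrightarrow> card (Rblock k2 1 \<inter> S) + card (Rblock k2 2 \<inter> S) = k2)"
  by (auto simp: minimal_subset_def comb_type_def)

text \<open>No variable in a column outside of \<open>S\<close> lies in \<open>I\<^sub>S\<close> (for \<open>t = 2\<close> because there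
  are no free blocks then, unless \<open>S\<close> is empty), which gives \<open>S' \<subseteq> S\<close>. If \<open>(p, j) \<in> S\<close> were missing
  in \<open>S'\<close>, block \<open>j\<close> would be free for \<open>S'\<close>, and the following matrix, on which \<open>I\<^sub>S\<close> vanishes, would
  refute the inclusion. Row \<open>p\<close> has at least \<open>t - 1\<close> blocks outside of
  \<open>S\<close>, by the upper bound on the type, and one of them, \<open>z\<close>, satisfies \<open>(q, z) \<in> S\<close> for the other row
  \<open>q\<close>, by the lower bound. Put distinct unit vectors with indices up to \<open>t - 1\<close> into \<open>t - 1\<close> of these
  blocks, in both rows unless the position belongs to \<open>S\<close>, with index \<open>t - 1\<close> at \<open>z\<close>, and the unit
  vector with index \<open>t\<close> at \<open>(q, j)\<close>. Row \<open>p\<close> misses index \<open>t\<close>, row \<open>q\<close> misses index \<open>t - 1\<close>, and the free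
  blocks of \<open>S\<close> miss both and have equal columns, so \<open>I\<^sub>S\<close> vanishes; but the free part of \<open>S'\<close> in
  row \<open>p\<close> contains all \<open>t\<close> unit vectors.\<close>

lemma eq_if_I_S_subset_minimal:
  assumes t: "2 \<le> t" "t \<le> k2" "t \<le> d" and S: "S \<subseteq> columns k2" and S': "S' \<subseteq> columns k2"
    and min: "minimal_subset k2 t S" and sub: "I_S d k2 t S' \<subseteq> I_S d k2 t S"
  shows "S' = S"
proof -
  have generic_S': "generic 1 c \<in> I_S d k2 t S" if "c \<in> S'" for c
    using generic_in_I_S[OF S' that, of 1 d t] sub t by auto
  show ?thesis
  proof (cases "S = {}")
    case True
    have "generic 1 c \<notin> I_S d k2 t {}" if "c \<in> S'" for c
      using that S' not_mixed_empty by (intro generic_not_in_I_S t(1)) auto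
    then show ?thesis using generic_S' True by blast
  next
    case False
    then have noblock: "\<And>j. j \<in> {1..k2} \<Longrightarrow> \<not> Cblock j \<subseteq> S"
      and rows: "\<And>p. p \<in> {1, 2} \<Longrightarrow> 1 \<le> card (Rblock k2 p \<inter> S)"
        "\<And>p. p \<in> {1, 2} \<Longrightarrow> card (Rblock k2 p \<inter> S) \<le> k2 - t + 1"
      and t2: "t = 2 \<Longrightarrow> card (Rblock k2 1 \<inter> S) + card (Rblock k2 2 \<inter> S) = k2"
      using min unfolding minimal_subset_iff by blast+
    have free: "Cfree k2 S = {}" if "t = 2"
    proof -
      let ?M = "{l\<in>{1..k2}. (1, l) \<notin> S \<and> (2, l) \<notin> S}"
      have "card ?M = 0"
        using card_rows_and_free_blocks[of k2 S, OF noblock] t2[OF that] by linarith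
      moreover have "finite ?M" by simp
      ultimately have "?M = {}" by (simp only: card_0_eq)
      then show ?thesis by (auto simp: Cfree_iff)
    qed
    have "S' \<subseteq> S"
    proof
      fix c assume c: "c \<in> S'"
      show "c \<in> S"
      proof (rule ccontr)
        assume "c \<notin> S"
        then have "generic 1 c \<notin> I_S d k2 t S"
          using free c S' by (intro generic_not_in_I_S S t(1)) auto
        then show False using generic_S'[OF c] by blast
      qed
    qed
    moreover have "S \<subseteq> S'"
    proof (rule ccontr)
      assume "\<not> S \<subseteq> S'"
      then obtain p j where pj: "(p, j) \<in> S" "(p, j) \<notin> S'" by auto
      then have p: "p \<in> {1, 2}" and j: "j \<in> {1..k2}" using S by (auto simp: columns_iff subset_iff)
      define q where "q = 3 - p"
      have pq: "q \<in> {1, 2}" "p \<noteq> q" "{1, 2} = {p, q}" using p by (auto simp: q_def)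
      have noblock': "\<not> ((p, l) \<in> S \<and> (q, l) \<in> S)" if "l \<in> {1..k2}" for l
        using noblock[OF that] p unfolding Cblock_subset_iff q_def by auto
      define L where "L = {l\<in>{1..k2}. (p, l) \<notin> S}"
      have cardL: "t - 1 \<le> card L"
        using rows(2)[OF p] t unfolding L_def card_not_in_row by simp
      have "Rblock k2 q \<inter> S \<noteq> {}" using rows(1)[OF pq(1)] by force
      then obtain z where z: "z \<in> {1..k2}" "(q, z) \<in> S" unfolding Rblock_def by blast
      then have zL: "z \<in> L" using noblock' by (auto simp: L_def)
      have finL: "finite L" by (simp add: L_def)
      have "t - 2 \<le> card (L - {z})" using cardL zL finL by (simp add: card_Diff_singleton)
      then obtain L' where L': "L' \<subseteq> L - {z}" "card L' = t - 2" "finite L'"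
        using obtain_subset_with_card_n by metis
      then obtain h where h: "bij_betw h {..<t - 2} L'"
        using ex_bij_betw_nat_finite[of L'] by (auto simp: atLeast0LessThan)
      \<comment> \<open>The index of the unit vector in block \<open>l\<close>; blocks that are not selected get 0.\<close>
      define n where "n l = (if l \<in> L' then Suc (inv_into {..<t - 2} h l) else if l = z then t - 1 else 0)" for l
      have n_le: "n l \<in> insert 0 {1..t - 1}" for l
        using bij_betw_apply[OF bij_betw_inv_into[OF h], of l] t by (auto simp: n_def)
      have n_le': "n l \<in> insert 0 {1..t - 2}" if "l \<noteq> z" for l
        using bij_betw_apply[OF bij_betw_inv_into[OF h], of l] that by (auto simp: n_def)
      define e where "e = (\<lambda>(r, l). if (r, l) \<in> S then 0 else if (p, l) \<notin> S then n l
        else if l = j then t else 0)"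
      have e1: "e (r, l) \<in> insert 0 {1..t - 1}" if "(p, l) \<notin> S" for r l
        using n_le[of l] that by (simp add: e_def)
      have e2: "e (r, l) \<in> insert 0 (insert t {1..t - 2})" if "l \<noteq> z" for r l
        using n_le'[OF that] by (auto simp: e_def)
      have e3: "e (r, l) \<in> insert 0 {1..t - 2}" if "l \<noteq> z" "(p, l) \<notin> S" for r l
        using n_le'[OF that(1)] that(2) by (simp add: e_def)
      let ?J = "vanishing_ideal d k2 (unit_columns e)"
      have "I_S d k2 t S \<subseteq> ?J"
        unfolding I_S_subset_iff[OF S ideal_vanishing_ideal]
      proof (intro conjI ballI impI)
        show "minors_in d ?J 1 S"
          by (rule minors_in_unit_columns[OF S, of "{}"]) (auto simp: e_def)
      next
        fix l assume l: "l \<in> {1..k2}" "Cblock l \<inter> S = {}"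
        then have "(p, l) \<notin> S" "(q, l) \<notin> S" using p pq(1) by (auto simp: Cblock_disjoint_iff)
        then have "e ` Cblock l \<subseteq> insert 0 {n l}"
          using pq(3) by (auto simp: e_def Cblock_iff)
        then show "minors_in d ?J 2 (Cblock l)"
          by (rule minors_in_unit_columns[OF Cblock_subset[OF l(1)], rotated 2]) auto
      next
        have "l \<noteq> z \<and> (p, l) \<notin> S" if "(r, l) \<in> Cfree k2 S" for r l
          using that z(2) pq(1) p by (auto simp: Cfree_iff)
        then have "e ` Cfree k2 S \<subseteq> insert 0 {1..t - 2}"
          using e3 by (metis image_subsetI surj_pair)
        then show "minors_in d ?J (t - 1) (Cfree k2 S)"
          by (rule minors_in_unit_columns[OF Cfree_subset, rotated 2]) (use t in auto)
      next
        fix r :: nat assume r: "r \<in> {1, 2}"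
        show "minors_in d ?J t (free_part k2 S r)"
        proof (cases "r = p")
          case True
          have "(p, l) \<notin> S" if "(r', l) \<in> free_part k2 S r" for r' l
            using that True p by (auto simp: free_part_iff)
          then have "e ` free_part k2 S r \<subseteq> insert 0 {1..t - 1}"
            using e1 by (metis image_subsetI surj_pair)
          then show ?thesis
            by (rule minors_in_unit_columns[OF free_part_subset[OF r], rotated 2]) (use t in auto)
        next
          case False
          then have "r = q" using r pq(3) by blast
          then have "l \<noteq> z" if "(r', l) \<in> free_part k2 S r" for r' l
            using that z(2) pq(1) by (auto simp: free_part_iff)
          then have "e ` free_part k2 S r \<subseteq> insert 0 (insert t {1..t - 2})"
            using e2 by (metis image_subsetI surj_pair)
          then show ?thesis
            by (rule minors_in_unit_columns[OF free_part_subset[OF r], rotated 2]) (use t in auto)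
        qed
      qed
      then have "minors_in d ?J t (free_part k2 S' p)"
        using sub p unfolding I_S_subset_iff[OF S' ideal_vanishing_ideal, symmetric]
        using I_S_subset_iff[OF S' ideal_vanishing_ideal, of d t "unit_columns e"] by blast
      moreover have "\<not> minors_in d ?J t (free_part k2 S' p)"
      proof -
        define g where "g k = (if k < t - 2 then (p, h k) else if k = t - 2 then (p, z) else (q, j))" for k
        have jq: "(q, j) \<notin> S" using noblock'[OF j] pj by blast
        have hL: "h k \<in> L'" if "k < t - 2" for k using bij_betw_apply[OF h] that by simp
        have pL: "(p, l) \<notin> S' \<and> (p, l) \<notin> S \<and> l \<in> {1..k2}" if "l \<in> L" for l
          using that \<open>S' \<subseteq> S\<close> by (auto simp: L_def)
        have "g k \<in> free_part k2 S' p" if "k < t" for k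
        proof -
          have "(q, j) \<in> free_part k2 S' p"
            using pj(2) jq \<open>S' \<subseteq> S\<close> pq p j by (auto simp: free_part_iff)
          moreover have "(p, l) \<in> free_part k2 S' p" if "l \<in> L" for l
            using pL[OF that] by (simp add: free_part_iff)
          ultimately show ?thesis using hL[of k] L'(1) zL by (auto simp: g_def)
        qed
        then have "g \<in> {..<t} \<rightarrow> free_part k2 S' p" by simp
        moreover have "e (g k) = Suc k" if k: "k < t" for k
        proof -
          consider "k < t - 2" | "k = t - 2" | "k = t - 1" "\<not> k < t - 2" "k \<noteq> t - 2"
            using k t by linarith
          then show ?thesis
          proof cases
            case 1
            then have "inv_into {..<t - 2} h (h k) = k"
              using bij_betw_inv_into_left[OF h] by simp
            then show ?thesis using 1 hL[OF 1] pL L'(1) by (auto simp: g_def e_def n_def)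
          next
            case 2
            then show ?thesis using pL[OF zL] L'(1) t by (auto simp: g_def e_def n_def)
          next
            case 3
            then show ?thesis using pj(1) jq t by (simp add: g_def e_def)
          qed
        qed
        ultimately show ?thesis
          by (intro not_minors_in_unit_columns[OF t(3) free_part_subset[OF p]])
      qed
      ultimately show False by blast
    qed
    ultimately show ?thesis by blast
  qed
qed


section \<open>Every ideal lies above one of a minimal subset\<close>

lemma strictly_smaller_I_S:
  assumes S: "S \<subseteq> columns k2" "S' \<subseteq> columns k2" and t: "2 \<le> t" "t \<le> d"
    and sub: "I_S d k2 t S' \<subseteq> I_S d k2 t S"
    and c: "generic 1 c \<in> I_S d k2 t S" "c \<in> columns k2" "c \<notin> S'"
    and special: "\<not> (mixed k2 S' \<and> t = 2 \<and> c \<in> Cfree k2 S')"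
  shows "\<exists>S'. S' \<subseteq> columns k2 \<and> I_S d k2 t S' \<subset> I_S d k2 t S"
proof -
  have "generic 1 c \<notin> I_S d k2 t S'"
    by (rule generic_not_in_I_S[OF S(2) t(1) c(2,3) special])
  then show ?thesis using S(2) sub c(1) by blast
qed

text \<open>One of the two members of a block contained in \<open>S\<close> can be released: the block still meets \<open>S\<close>, so
  the free blocks stay the same, and the free parts only gain a column that is zero modulo \<open>I\<^sub>S\<close>. The
  member has to be chosen so that its removal does not turn \<open>S\<close> into a mixed set, which would add
  generators of size \<open>t - 1\<close>.\<close>

lemma smaller_I_S_if_block:
  assumes t: "2 \<le> t" "t \<le> d" and S: "S \<subseteq> columns k2"
    and j: "j \<in> {1..k2}" "Cblock j \<subseteq> S"
  shows "\<exists>S'. S' \<subseteq> columns k2 \<and> I_S d k2 t S' \<subset> I_S d k2 t S"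
proof -
  let ?J = "I_S d k2 t S"
  have in_S: "(1, j) \<in> S" "(2, j) \<in> S" using j(2) by (simp_all add: Cblock_subset_iff)
  obtain p where p: "p \<in> {1, 2}" and mix: "mixed k2 (S - {(p, j)}) \<Longrightarrow> mixed k2 S"
  proof (cases "mixed k2 S")
    case True
    then show thesis using that[of 1] by blast
  next
    case False
    then obtain p where p: "p \<in> {1, 2}"
      and only: "\<And>l. l \<in> {1..k2} \<Longrightarrow> (p, l) \<in> S \<Longrightarrow> (3 - p, l) \<in> S"
      unfolding mixed_def by blast
    have "3 - p \<noteq> p" using p by auto
    then have "\<not> mixed k2 (S - {(p, j)})" using only p unfolding mixed_def by blast
    then show thesis using that[OF p] by blast
  qed
  let ?S' = "S - {(p, j)}"
  have S': "?S' \<subseteq> columns k2" using S by blast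
  have pj: "(p, j) \<in> S" using in_S p by auto
  have nfree: "(r, j) \<notin> Cfree k2 ?S'" for r using in_S p by (auto simp: Cfree_iff)
  have Cfree: "Cfree k2 ?S' = Cfree k2 S"
  proof (rule Set.set_eqI)
    fix c show "c \<in> Cfree k2 ?S' \<longleftrightarrow> c \<in> Cfree k2 S"
      using in_S nfree by (cases c, cases "snd c = j") (auto simp: Cfree_iff)
  qed
  have "?J \<supseteq> I_S d k2 t ?S'"
  proof (rule I_S_subset_I_SI[OF S S'])
    show "minors_in d ?J 1 ?S'"
      using I_S_contains[OF S, of d t] minors_in_mono[of d ?J 1 S ?S'] by blast
    show "minors_in d ?J (t - 1) (Cfree k2 ?S')" if "mixed k2 ?S'"
      using I_S_contains[OF S, of d t] mix[OF that] unfolding Cfree by blast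
    show "minors_in d ?J t (free_part k2 ?S' q)" if q: "q \<in> {1, 2}" for q
      by (rule minors_in_I_S_up_to_S[OF S q]) (auto simp: free_part_def Cfree)
  qed
  then show ?thesis
    using nfree[of p] pj S t
    by (intro strictly_smaller_I_S[OF S S' t, of "(p, j)"] generic_in_I_S) auto
qed

text \<open>If \<open>S\<close> lies in one row, the free part in the other row comprises all columns outside of \<open>S\<close>,
  so \<open>I\<^sub>S\<close> contains all minors of size \<open>t\<close> and with them the ideal of the empty set.\<close>

lemma smaller_I_S_if_empty_row:
  assumes t: "2 \<le> t" "t \<le> d" and S: "S \<subseteq> columns k2" "S \<noteq> {}"
    and p: "p \<in> {1, 2}" "Rblock k2 p \<inter> S = {}"
  shows "\<exists>S'. S' \<subseteq> columns k2 \<and> I_S d k2 t S' \<subset> I_S d k2 t S"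
proof -
  let ?J = "I_S d k2 t S"
  have np: "(p, l) \<notin> S" if "l \<in> {1..k2}" for l using p(2) that unfolding Rblock_def by blast
  have cover: "columns k2 \<subseteq> free_part k2 S p \<union> S"
    using np p(1) by (auto simp: columns_iff free_part_iff)
  have "I_S d k2 t {} \<subseteq> ?J"
  proof (rule I_S_subset_I_SI[OF S(1)])
    show "minors_in d ?J 1 {}" unfolding minors_in_1_iff by blast
    show "minors_in d ?J t (free_part k2 {} q)" if q: "q \<in> {1, 2}" for q
      by (rule minors_in_I_S_up_to_S[OF S(1) p(1)]) (use free_part_subset[OF q] cover in blast)
  qed (use not_mixed_empty in auto)
  moreover obtain c where "c \<in> S" using S(2) by auto
  ultimately show ?thesis
    using S(1) not_mixed_empty t
    by (intro strictly_smaller_I_S[OF S(1) _ t, of "{}" c] generic_in_I_S) auto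
qed

text \<open>If row \<open>p\<close> of \<open>S\<close> is too long, fewer than \<open>t - 1\<close> blocks of that row are left. Releasing one
  element \<open>(p, j)\<close> still leaves too few blocks for the new minors: each has two columns in one block.\<close>

lemma smaller_I_S_if_long_row:
  assumes t: "2 \<le> t" "t \<le> d" and S: "S \<subseteq> columns k2"
    and noblock: "\<And>l. l \<in> {1..k2} \<Longrightarrow> \<not> Cblock l \<subseteq> S"
    and p: "p \<in> {1, 2}" "k2 - t + 1 < card (Rblock k2 p \<inter> S)" "t \<le> k2"
    and q: "q = 3 - p" "Rblock k2 q \<inter> S \<noteq> {}"
  shows "\<exists>S'. S' \<subseteq> columns k2 \<and> I_S d k2 t S' \<subset> I_S d k2 t S"
proof -
  let ?J = "I_S d k2 t S"
  have pq: "q \<in> {1, 2}" "p \<noteq> q" "{1, 2} = {p, q}" using p(1) q(1) by auto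
  have noblock': "\<not> ((p, l) \<in> S \<and> (q, l) \<in> S)" if "l \<in> {1..k2}" for l
    using noblock[OF that] p(1) q(1) unfolding Cblock_subset_iff by auto
  have "Rblock k2 p \<inter> S \<noteq> {}" using p(2) by auto
  then obtain j where j: "j \<in> {1..k2}" "(p, j) \<in> S" unfolding Rblock_def by blast
  obtain z where z: "z \<in> {1..k2}" "(q, z) \<in> S" using q(2) unfolding Rblock_def by blast
  have "z \<noteq> j" using noblock' j z by blast
  define L where "L = {l\<in>{1..k2}. (p, l) \<notin> S}"
  have finL: "finite L" by (simp add: L_def)
  have cardL: "card L < t - 1" using p(2,3) t(1) unfolding L_def card_not_in_row by linarith
  have zL: "z \<in> L" using noblock' z by (auto simp: L_def)
  \<comment> \<open>Block \<open>z\<close> is left over in row \<open>p\<close> but is not free. This makes room for \<open>j\<close> among the fewer than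
    \<open>t - 1\<close> blocks, which the minors of size \<open>t - 1\<close> need.\<close>
  let ?S' = "S - {(p, j)}"
  have S': "?S' \<subseteq> columns k2" using S by blast
  have few: "minors_in d ?J r U"
    if "U \<subseteq> columns k2" "finite K" "snd ` U \<subseteq> K" "card K < r" for r U K
    by (rule minors_in_few_blocks[OF ideal_I_S _ that]) (rule I_S_contains_blocks[OF S])
  have "I_S d k2 t ?S' \<subseteq> ?J"
  proof (rule I_S_subset_I_SI[OF S S'])
    show "minors_in d ?J 1 ?S'"
      using I_S_contains[OF S, of d t] minors_in_mono[of d ?J 1 S ?S'] by blast
  next
    have "snd ` Cfree k2 ?S' \<subseteq> insert j (L - {z})"
      using z(2) \<open>z \<noteq> j\<close> p(1) pq(1) by (auto simp: Cfree_iff L_def)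
    moreover have "card (insert j (L - {z})) < t - 1"
    proof -
      have "card (insert j (L - {z})) \<le> Suc (card (L - {z}))" by (rule card_insert_le_m1) auto
      also have "\<dots> \<le> card L" using card_Diff1_less[OF finL zL] by simp
      finally show ?thesis using cardL by simp
    qed
    ultimately show "minors_in d ?J (t - 1) (Cfree k2 ?S')"
      using finL by (intro few[OF Cfree_subset, of "insert j (L - {z})"]) simp_all
  next
    fix r :: nat assume r: "r \<in> {1, 2}"
    show "minors_in d ?J t (free_part k2 ?S' r)"
    proof (cases "r = p")
      case True
      have "snd ` free_part k2 ?S' r \<subseteq> insert j L"
        using p(1) True by (auto simp: free_part_iff L_def)
      moreover have "card (insert j L) < t"
        using card_insert_le_m1[of "t - 1" L j] cardL by (simp add: card_insert_if finL) linarith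
      ultimately show ?thesis using finL by (intro few[OF free_part_subset[OF r], of "insert j L"]) simp_all
    next
      case False
      then have "r = q" using r pq(3) by blast
      have "c \<in> free_part k2 S q \<union> S" if "c \<in> free_part k2 ?S' q" for c
      proof (cases c)
        case (Pair m l)
        then show ?thesis
          using that j noblock'[OF j(1)] p(1) pq by (cases "l = j") (auto simp: free_part_iff)
      qed
      then show ?thesis
        unfolding \<open>r = q\<close> by (intro minors_in_I_S_up_to_S[OF S pq(1)]) blast
    qed
  qed
  moreover have "t \<noteq> 2" using cardL zL finL by (auto simp: card_eq_0_iff)
  ultimately show ?thesis
    using j S t by (intro strictly_smaller_I_S[OF S S' t, of "(p, j)"] generic_in_I_S) auto
qed

text \<open>For \<open>t = 2\<close> and \<open>S\<close> mixed, the ideal contains the variables of all free blocks. Adding one of the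
  two columns of such a block to \<open>S\<close> keeps this column zero and releases the other one.\<close>

lemma smaller_I_S_if_free_block:
  assumes t: "t = 2" "t \<le> d" and S: "S \<subseteq> columns k2" and mix: "mixed k2 S"
    and j: "j \<in> {1..k2}" "(1, j) \<notin> S" "(2, j) \<notin> S"
  shows "\<exists>S'. S' \<subseteq> columns k2 \<and> I_S d k2 t S' \<subset> I_S d k2 t S"
proof -
  let ?J = "I_S d k2 t S" and ?S' = "insert (1, j) S"
  have S': "?S' \<subseteq> columns k2" using S j by (simp add: columns_iff)
  have J1: "minors_in d ?J 1 (Cfree k2 S)" using I_S_contains[OF S, of d t] mix t by simp
  have free: "(1, j) \<in> Cfree k2 S" "(2, j) \<in> Cfree k2 S" using j by (simp_all add: Cfree_iff)
  have Cfree: "Cfree k2 ?S' \<subseteq> Cfree k2 S" by (auto simp: Cfree_iff)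
  have "I_S d k2 t ?S' \<subseteq> ?J"
  proof (rule I_S_subset_I_SI[OF S S'])
    show "minors_in d ?J 1 ?S'"
      using I_S_contains[OF S, of d t] J1 free(1) unfolding minors_in_1_iff by blast
    show "minors_in d ?J (t - 1) (Cfree k2 ?S')"
      using minors_in_mono[OF J1 Cfree] t by simp
    show "minors_in d ?J t (free_part k2 ?S' q)" if q: "q \<in> {1, 2}" for q
      by (rule minors_in_I_S_up_to_S[OF S q]) (use Cfree in \<open>auto simp: free_part_def\<close>)
  qed
  moreover have "generic 1 (2, j) \<in> ?J"
    using J1 free(2) t unfolding minors_in_1_iff by simp
  ultimately show ?thesis
    using j t by (intro strictly_smaller_I_S[OF S S', of t d "(2, j)"])
      (auto simp: columns_iff Cfree_iff)
qed

lemma smaller_I_S_if_not_minimal: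
  assumes t: "2 \<le> t" "t \<le> k2" "t \<le> d" and S: "S \<subseteq> columns k2" and "\<not> minimal_subset k2 t S"
  shows "\<exists>S'. S' \<subseteq> columns k2 \<and> I_S d k2 t S' \<subset> I_S d k2 t S"
proof (cases "\<exists>j\<in>{1..k2}. Cblock j \<subseteq> S")
  case True
  then show ?thesis using smaller_I_S_if_block[OF t(1,3) S] by blast
next
  case noblock: False
  have ne: "S \<noteq> {}" using assms(5) by (auto simp: minimal_subset_def)
  show ?thesis
  proof (cases "\<exists>p\<in>{1, 2}. Rblock k2 p \<inter> S = {}")
    case True
    then show ?thesis using smaller_I_S_if_empty_row[OF t(1,3) S ne] by blast
  next
    case False
    then have rows: "Rblock k2 p \<inter> S \<noteq> {}" if "p \<in> {1, 2}" for p using that by blast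
    have "1 \<le> card (Rblock k2 p \<inter> S)" if "p \<in> {1, 2}" for p
      using rows[OF that] finite_subset[of "Rblock k2 p \<inter> S" "{p} \<times> {1..k2}"]
      by (simp add: Rblock_def Suc_le_eq card_gt_0_iff)
    then consider p where "p \<in> {1, 2}" "k2 - t + 1 < card (Rblock k2 p \<inter> S)"
      | "t = 2" "card (Rblock k2 1 \<inter> S) + card (Rblock k2 2 \<inter> S) \<noteq> k2"
      using assms(5) noblock unfolding minimal_subset_iff by (metis not_le)
    then show ?thesis
    proof cases
      case 1
      have "3 - p \<in> {1, 2}" using 1(1) by auto
      then show ?thesis
        using smaller_I_S_if_long_row[OF t(1,3) S _ 1 t(2) refl rows] noblock by blast
    next
      case 2
      have "{l\<in>{1..k2}. (1, l) \<notin> S \<and> (2, l) \<notin> S} \<noteq> {}"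
        using card_rows_and_free_blocks[of k2 S] noblock 2(2) by (metis add_0_right card.empty)
      then obtain j where j: "j \<in> {1..k2}" "(1, j) \<notin> S" "(2, j) \<notin> S" by blast
      have "mixed k2 S"
        unfolding mixed_def
      proof
        fix p :: nat assume p: "p \<in> {1, 2}"
        then obtain l where "l \<in> {1..k2}" "(p, l) \<in> S" using rows[OF p] unfolding Rblock_def by blast
        then show "\<exists>j\<in>{1..k2}. (p, j) \<in> S \<and> (3 - p, j) \<notin> S"
          using noblock p unfolding Cblock_subset_iff by auto
      qed
      then show ?thesis using smaller_I_S_if_free_block[OF 2(1) t(3) S _ j] by blast
    qed
  qed
qed


section \<open>Every point of the variety of \<open>I\<^sub>C\<close> lies on the variety of some \<open>I\<^sub>S\<close>\<close>

text \<open>Cramer's rule for size 1.\<close>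

lemma multiple_in_block:
  fixes x :: "nat \<times> col \<Rightarrow> complex"
  assumes van: "minors_vanish (\<lambda>i c. x (i, c)) R U 2"
    and c: "c \<in> U" "c' \<in> U" and nz: "i \<in> R" "x (i, c) \<noteq> 0"
  shows "\<exists>\<mu>. \<forall>i\<in>R. x (i, c') = \<mu> * x (i, c)"
proof -
  have "spanned_by (\<lambda>i c. x (i, c)) R 1 (\<lambda>_. c) c'"
  proof (rule spanned_by_nonzero_minor)
    show "minors_vanish (\<lambda>i c. x (i, c)) R U (Suc 1)" using van by (simp add: numeral_2_eq_2)
    show "subdet (\<lambda>i c. x (i, c)) 1 (\<lambda>_. i) (\<lambda>_. c) \<noteq> 0" using nz by (simp only: subdet_1, simp)
  qed (use c nz in auto)
  then obtain l where "\<forall>i\<in>R. x (i, c') = (\<Sum>k<1::nat. x (i, c) * l k)"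
    unfolding spanned_by_def by blast
  then have "\<forall>i\<in>R. x (i, c') = l 0 * x (i, c)" by simp
  then show ?thesis by blast
qed

text \<open>If the whole matrix has rank below \<open>t\<close>, take \<open>S = {}\<close>; otherwise let \<open>S\<close> be the set of its zero
  columns. Every column of a free part is then a multiple of a column in the corresponding row of
  blocks, which has rank below \<open>t\<close>. If the free blocks had rank \<open>t - 1\<close>, they would span the same
  space as either row, and the whole matrix would have rank \<open>t - 1\<close>. So the minors of size \<open>t - 1\<close>
  vanish on the free blocks.\<close>

lemma I_S_vanishing_at_point_of_I_C:
  assumes t: "2 \<le> t" and C: "I_C d k2 t \<subseteq> vanishing_ideal d k2 x"
  shows "\<exists>S\<subseteq>columns k2. I_S d k2 t S \<subseteq> vanishing_ideal d k2 x"
proof -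
  let ?J = "vanishing_ideal d k2 x" and ?a = "\<lambda>i c. x (i, c)"
  note J = ideal_vanishing_ideal[of d k2 x]
  have blocks: "minors_in d ?J 2 (Cblock j)" if "j \<in> {1..k2}" for j
    using C that unfolding I_C_subset_iff[OF J] by blast
  have rows: "minors_in d ?J t (Rblock k2 p)" if "p \<in> {1, 2}" for p
    using C that unfolding I_C_subset_iff[OF J] by blast
  show ?thesis
  proof (cases "minors_in d ?J t (columns k2)")
    case True
    have "I_S d k2 t {} \<subseteq> ?J"
      unfolding I_S_subset_iff[OF empty_subsetI J]
      using blocks not_mixed_empty minors_in_mono[OF True free_part_subset]
      by (simp add: minors_in_1_iff[unfolded One_nat_def])
    then show ?thesis by blast
  next
    case False
    define S where "S = {c \<in> columns k2. \<forall>i\<in>{1..d}. x (i, c) = 0}"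
    have S: "S \<subseteq> columns k2" by (auto simp: S_def)
    have zero: "minors_in d ?J 1 S"
      unfolding minors_in_vanishing_ideal_iff[OF S] minors_vanish_def subdet_1
      by (auto simp: S_def)
    have multiple: "\<exists>c'\<in>Rblock k2 p. \<exists>\<mu>. \<forall>i\<in>{1..d}. x (i, c) = \<mu> * x (i, c')"
      if c: "c \<in> free_part k2 S p" and p: "p \<in> {1, 2}" for c p
    proof -
      obtain r l where c_eq: "c = (r, l)" by (cases c)
      have l: "l \<in> {1..k2}" and r: "r \<in> {1, 2}" and nS: "(p, l) \<notin> S"
        using c p by (auto simp: c_eq free_part_iff)
      have "(p, l) \<in> columns k2" using p l by (simp add: columns_iff)
      then obtain i where "i \<in> {1..d}" "x (i, (p, l)) \<noteq> 0" using nS by (auto simp: S_def)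
      moreover have "minors_vanish ?a {1..d} (Cblock l) 2"
        using blocks[OF l] minors_in_vanishing_ideal_iff[OF Cblock_subset[OF l]] by blast
      ultimately have "\<exists>\<mu>. \<forall>i\<in>{1..d}. x (i, (r, l)) = \<mu> * x (i, (p, l))"
        using p r by (intro multiple_in_block[of x "{1..d}" "Cblock l"]) (simp_all add: Cblock_iff)
      then show ?thesis using l p unfolding c_eq by (intro bexI[of _ "(p, l)"]) (simp_all add: Rblock_iff)
    qed
    have free: "minors_in d ?J t (free_part k2 S p)" if p: "p \<in> {1, 2}" for p
      using rows[OF p] minors_vanish_multiples[OF _ multiple[OF _ p]]
      unfolding minors_in_vanishing_ideal_iff[OF Rblock_subset[OF p]]
        minors_in_vanishing_ideal_iff[OF free_part_subset[OF p]] by blast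
    have "minors_in d ?J (t - 1) (Cfree k2 S)"
    proof (rule ccontr)
      assume n: "\<not> minors_in d ?J (t - 1) (Cfree k2 S)"
      let ?F = "free_part k2 S"
      have sub: "?F 1 \<union> ?F 2 \<subseteq> columns k2" using free_part_subset[of 1 k2 S] free_part_subset[of 2 k2 S] by simp
      have van: "minors_vanish ?a {1..d} (?F p) t" if p: "p \<in> {1, 2}" for p
        using free[OF p] minors_in_vanishing_ideal_iff[OF free_part_subset[OF p]] by blast
      have "\<not> minors_vanish ?a {1..d} (Cfree k2 S) (t - 1)"
        using n minors_in_vanishing_ideal_iff[OF Cfree_subset] by blast
      then have "\<not> minors_vanish ?a {1..d} (?F 1 \<inter> ?F 2) (t - 1)"
        using minors_vanish_mono[of ?a "{1..d}" "?F 1 \<inter> ?F 2" "t - 1" "Cfree k2 S"]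
        unfolding free_part_def by blast
      moreover have Suc_t: "Suc (t - 1) = t" using t by simp
      ultimately have "minors_vanish ?a {1..d} (?F 1 \<union> ?F 2) t"
        using minors_vanish_union[of ?a "{1..d}" "?F 1" "t - 1" "?F 2"] van unfolding Suc_t by blast
      then have "minors_in d ?J t (?F 1 \<union> ?F 2)"
        using minors_in_vanishing_ideal_iff[OF sub] by blast
      from minors_in_zero_columns[OF J _ this zero]
      have "minors_in d ?J t ((?F 1 \<union> ?F 2) \<union> S)" using sub S by simp
      moreover have "columns k2 \<subseteq> (?F 1 \<union> ?F 2) \<union> S"
        by (auto simp: columns_iff free_part_iff)
      ultimately show False using False minors_in_mono by blast
    qed
    then have "I_S d k2 t S \<subseteq> ?J"
      unfolding I_S_subset_iff[OF S J] using zero blocks free by blast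
    then show ?thesis using S by blast
  qed
qed

theorem theorem3p8:
  fixes d k2 t :: nat
  assumes "2 \<le> t" and "t \<le> min k2 d"
  shows "radical (CX d k2) (I_C d k2 t) =
           (\<Inter>S\<in>{S. S \<subseteq> columns k2 \<and> minimal_subset k2 t S}. radical (CX d k2) (I_S d k2 t S))
       \<and> (\<forall>S. S \<subseteq> columns k2 \<longrightarrow>
            (minimal_subset k2 t S \<longleftrightarrow>
             \<not> (\<exists>S'. S' \<subseteq> columns k2 \<and> I_S d k2 t S' \<subset> I_S d k2 t S)))"
proof (rule conjI)
  have t: "2 \<le> t" "t \<le> k2" "t \<le> d" using assms by auto
  have minimal: "minimal_subset k2 t S \<longleftrightarrow>
      \<not> (\<exists>S'. S' \<subseteq> columns k2 \<and> I_S d k2 t S' \<subset> I_S d k2 t S)" if S: "S \<subseteq> columns k2" for S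
    using eq_if_I_S_subset_minimal[OF t S] smaller_I_S_if_not_minimal[OF t S] by blast
  then show "\<forall>S. S \<subseteq> columns k2 \<longrightarrow> (minimal_subset k2 t S \<longleftrightarrow>
      \<not> (\<exists>S'. S' \<subseteq> columns k2 \<and> I_S d k2 t S' \<subset> I_S d k2 t S))" by blast
  let ?\<M> = "{S. S \<subseteq> columns k2 \<and> minimal_subset k2 t S}"
  have rad: "radical (CX d k2) I = {f \<in> carrier (CX d k2). \<exists>n\<ge>1. f ^ n \<in> I}" for I
    by (simp add: CX_def radical_poly_ring)
  show "radical (CX d k2) (I_C d k2 t) = (\<Inter>S\<in>?\<M>. radical (CX d k2) (I_S d k2 t S))"
  proof
    show "radical (CX d k2) (I_C d k2 t) \<subseteq> (\<Inter>S\<in>?\<M>. radical (CX d k2) (I_S d k2 t S))"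
    proof (rule INF_greatest)
      fix S assume "S \<in> ?\<M>"
      then have "I_C d k2 t \<subseteq> I_S d k2 t S" by (intro I_C_subset_I_S) simp
      then show "radical (CX d k2) (I_C d k2 t) \<subseteq> radical (CX d k2) (I_S d k2 t S)"
        by (auto simp: rad)
    qed
  next
    show "(\<Inter>S\<in>?\<M>. radical (CX d k2) (I_S d k2 t S)) \<subseteq> radical (CX d k2) (I_C d k2 t)"
    proof (rule subsetI, rule ccontr)
      fix f assume f: "f \<in> (\<Inter>S\<in>?\<M>. radical (CX d k2) (I_S d k2 t S))"
        and nf: "f \<notin> radical (CX d k2) (I_C d k2 t)"
      have "{} \<in> ?\<M>" by (simp add: minimal_subset_def)
      then have fc: "f \<in> carrier (CX d k2)" using f unfolding rad by blast
      have "finite ({1..d} \<times> columns k2)" by (simp add: columns_def)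
      then obtain x where x: "\<And>g. g \<in> I_C d k2 t \<Longrightarrow> eval_mpoly x g = 0" "eval_mpoly x f \<noteq> 0"
        using nullstellensatz[OF _ ideal_I_C[unfolded CX_def] fc[unfolded CX_def] nf[unfolded CX_def]]
        by metis
      have "I_C d k2 t \<subseteq> vanishing_ideal d k2 x"
        using x(1) ideal_poly_ringD(1)[OF ideal_I_C[of d k2 t, unfolded CX_def]]
        by (auto simp: vanishing_ideal_def CX_def)
      then have "\<exists>S\<subseteq>columns k2. I_S d k2 t S \<subseteq> vanishing_ideal d k2 x"
        by (rule I_S_vanishing_at_point_of_I_C[OF t(1)])
      then obtain S where S: "S \<subseteq> columns k2" "I_S d k2 t S \<subseteq> vanishing_ideal d k2 x"
        by (elim exE conjE) (rule that)
      let ?\<I> = "I_S d k2 t ` Pow (columns k2)"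
      have "finite ?\<I>" by (simp add: columns_def)
      moreover have "I_S d k2 t S \<in> ?\<I>" using S(1) by simp
      ultimately obtain I where I: "I \<in> ?\<I>" "I \<subseteq> I_S d k2 t S"
        and I_min: "\<forall>I'\<in>?\<I>. I' \<subseteq> I \<longrightarrow> I = I'"
        by (rule finite_has_minimal2[THEN bexE]) simp
      from I(1) obtain T where T: "T \<subseteq> columns k2" "I = I_S d k2 t T" by auto
      have "minimal_subset k2 t T"
        unfolding minimal[OF T(1)]
      proof
        assume "\<exists>S'. S' \<subseteq> columns k2 \<and> I_S d k2 t S' \<subset> I_S d k2 t T"
        then obtain S' where "I_S d k2 t S' \<in> ?\<I>" "I_S d k2 t S' \<subset> I" using T(2) by auto
        then show False using I_min by auto
      qed
      then have "f \<in> radical (CX d k2) (I_S d k2 t T)" using f T(1) by simp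
      then obtain n where "f ^ n \<in> I_S d k2 t T" unfolding rad by auto
      then have "f ^ n \<in> vanishing_ideal d k2 x" using I(2) S(2) T(2) by (metis subsetD)
      then have "eval_mpoly x (f ^ n) = 0" by (simp add: vanishing_ideal_def)
      then show False using x(2) by (simp add: eval.hom_power)
    qed
  qed
qed

end
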